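(* Let $J$ be a unital Jordan algebra over $k$, let $J_+$ and $J_-$ be two copies of $J$, and let $\langle J,J\rangle=(J\otimes J)/\mathrm{span}\{a^2\otimes a-1\otimes a^3:a\in J\}$. Then the $k$-module $\widehat{\mathrm{TKK}}(J)=J_-\oplus\langle J,J\rangle\oplus J_+$ together with the bracket $$[a+X+b,\,c+Y+d]=(Xc-Ya)+([X,Y]+\langle a,d\rangle-\langle c,b\rangle)+(Xd-Yb)$$ for $X,Y\in\langle J,J\rangle$, $a,c\in J_-$, $b,d\in J_+$, is a $3$-graded Lie algebra (with components $J_-$, $\langle J,J\rangle$, $J_+$ in degrees $-1,0,1$).
   Context: $k$ is a unital commutative ring with no $2$- or $3$-torsion; modules and tensor products are over $k$. A Jordan algebra is a $k$-module $J$ with a bilinear product satisfying $ab=ba$ and $(a^2b)a=a^2(ba)$; $1$ is its identity element, $a^3=a^2a$. Put $\{a,b,c\}=(ab)c+a(bc)-b(ca)$. $\langle a,b\rangle$ denotes the coset of $a\otimes b$ in $\langle J,J\rangle$. The products occurring in the bracket are: $\langle a,b\rangle c=\{a,b,c\}\in J_-$ for $c\in J_-$; $\langle a,b\rangle d=-\{b,a,d\}\in J_+$ for $d\in J_+$; and $[\langle a,b\rangle,\langle c,d\rangle]=\langle\{a,b,c\},d\rangle-\langle c,\{b,a,d\}\rangle$, all extended linearly. A $3$-graded Lie algebra is $L=L_{-1}\oplus L_0\oplus L_1$ with $[L_i,L_j]\subseteq L_{i+j}$ ($L_i=0$ for $|i|>1$).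
   Formalization: Adds the hypothesis that ⟨J,J⟩ has no 2-torsion (automatic if 2 is invertible in k). No 2- or 3-torsion in k alone does not suffice: for k=ℤ, J=ℤ[t]/(t³), X=⟨1,t⟩ one gets [X,X]=⟨t,t⟩−⟨1,t²⟩ with 2[X,X]≠0. *)

theory Defs
  imports
    "HOL-Algebra.Module"
    "HOL-Algebra.Algebraic_Closure_Type"
    "HOL-Library.Poly_Mapping"
begin

text \<open>
  The ground ring \<open>k\<close> is a type of class \<^class>\<open>comm_ring_1\<close> and the Jordan algebra \<open>J\<close> is a type
  carrying a \<open>k\<close>-module structure in the sense of \<open>HOL.Modules\<close>. Modules built from them (quotients,
  direct sums) live on proper carriers, hence are modules in the sense of \<open>HOL-Algebra\<close> over
  \<open>ring_of_type_algebra\<close>. In the \<open>HOL-Algebra\<close> module records the fields \<open>mult\<close> and \<open>one\<close> are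
  meaningless.
\<close>

abbreviation base_ring :: "'k::comm_ring_1 ring"
  where "base_ring \<equiv> ring_of_type_algebra"

definition module_of :: "('k::comm_ring_1 \<Rightarrow> 'm::ab_group_add \<Rightarrow> 'm) \<Rightarrow> ('k, 'm) module"
  where "module_of scale =
    \<lparr>carrier = UNIV, monoid.mult = undefined, monoid.one = undefined, zero = 0, add = (+), module.smult = scale\<rparr>"


section \<open>Spans, quotients and tensor products of modules\<close>

definition module_span :: "('k, 'r) ring_scheme \<Rightarrow> ('k, 'm) module \<Rightarrow> 'm set \<Rightarrow> 'm set"
  where "module_span R M S = \<Inter>{N. submodule N R M \<and> S \<subseteq> N}"

definition quotient_module :: "('k, 'm) module \<Rightarrow> 'm set \<Rightarrow> ('k, 'm set) module"
  where "quotient_module M N =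
    \<lparr>carrier = a_rcosets\<^bsub>M\<^esub> N, monoid.mult = undefined, monoid.one = undefined, zero = N, add = set_add M,
     module.smult = (\<lambda>c U. \<Union>x\<in>U. N +>\<^bsub>M\<^esub> (c \<odot>\<^bsub>M\<^esub> x))\<rparr>"

definition free_scale :: "'k::comm_ring_1 \<Rightarrow> ('b \<Rightarrow>\<^sub>0 'k) \<Rightarrow> ('b \<Rightarrow>\<^sub>0 'k)"
  where "free_scale c = Poly_Mapping.map ((*) c)"

abbreviation pure :: "'a \<Rightarrow> 'b \<Rightarrow> ('a \<times> 'b \<Rightarrow>\<^sub>0 'k::comm_ring_1)"
  where "pure a b \<equiv> Poly_Mapping.single (a, b) 1"

definition tensor_relations ::
  "('k::comm_ring_1 \<Rightarrow> 'a::ab_group_add \<Rightarrow> 'a) \<Rightarrow> ('k \<Rightarrow> 'b::ab_group_add \<Rightarrow> 'b)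
    \<Rightarrow> ('a \<times> 'b \<Rightarrow>\<^sub>0 'k) set"
  where "tensor_relations s t =
    {pure (a + a') b - pure a b - pure a' b | a a' b. True} \<union>
    {pure a (b + b') - pure a b - pure a b' | a b b'. True} \<union>
    {pure (s c a) b - free_scale c (pure a b) | c a b. True} \<union>
    {pure a (t c b) - free_scale c (pure a b) | c a b. True}"

definition tensor_kernel ::
  "('k::comm_ring_1 \<Rightarrow> 'a::ab_group_add \<Rightarrow> 'a) \<Rightarrow> ('k \<Rightarrow> 'b::ab_group_add \<Rightarrow> 'b)
    \<Rightarrow> ('a \<times> 'b \<Rightarrow>\<^sub>0 'k) set"
  where "tensor_kernel s t = module_span base_ring (module_of free_scale) (tensor_relations s t)"

definition tensor_module ::
  "('k::comm_ring_1 \<Rightarrow> 'a::ab_group_add \<Rightarrow> 'a) \<Rightarrow> ('k \<Rightarrow> 'b::ab_group_add \<Rightarrow> 'b)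
    \<Rightarrow> ('k, ('a \<times> 'b \<Rightarrow>\<^sub>0 'k) set) module"
  where "tensor_module s t = quotient_module (module_of free_scale) (tensor_kernel s t)"

definition tensor ::
  "('k::comm_ring_1 \<Rightarrow> 'a::ab_group_add \<Rightarrow> 'a) \<Rightarrow> ('k \<Rightarrow> 'b::ab_group_add \<Rightarrow> 'b)
    \<Rightarrow> 'a \<Rightarrow> 'b \<Rightarrow> ('a \<times> 'b \<Rightarrow>\<^sub>0 'k) set"
  where "tensor s t a b = tensor_kernel s t +>\<^bsub>module_of free_scale\<^esub> pure a b"

definition bilinear_on ::
  "('k, 'a) module \<Rightarrow> ('k, 'b) module \<Rightarrow> ('k::comm_ring_1, 'c) module
    \<Rightarrow> ('a \<Rightarrow> 'b \<Rightarrow> 'c) \<Rightarrow> bool"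
  where "bilinear_on M N P f \<longleftrightarrow>
    (\<forall>x\<in>carrier M. \<forall>y\<in>carrier N. f x y \<in> carrier P) \<and>
    (\<forall>x\<in>carrier M. \<forall>x'\<in>carrier M. \<forall>y\<in>carrier N. f (x \<oplus>\<^bsub>M\<^esub> x') y = f x y \<oplus>\<^bsub>P\<^esub> f x' y) \<and>
    (\<forall>x\<in>carrier M. \<forall>y\<in>carrier N. \<forall>y'\<in>carrier N. f x (y \<oplus>\<^bsub>N\<^esub> y') = f x y \<oplus>\<^bsub>P\<^esub> f x y') \<and>
    (\<forall>c. \<forall>x\<in>carrier M. \<forall>y\<in>carrier N. f (c \<odot>\<^bsub>M\<^esub> x) y = c \<odot>\<^bsub>P\<^esub> f x y) \<and>
    (\<forall>c. \<forall>x\<in>carrier M. \<forall>y\<in>carrier N. f x (c \<odot>\<^bsub>N\<^esub> y) = c \<odot>\<^bsub>P\<^esub> f x y)"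


section \<open>Graded Lie algebras\<close>

locale lie_algebra = Module.module base_ring L
  for L :: "('k::comm_ring_1, 'l) module" (structure) +
  fixes bracket :: "'l \<Rightarrow> 'l \<Rightarrow> 'l"
  assumes bracket_bilinear: "bilinear_on L L L bracket"
    and bracket_alternating: "x \<in> carrier L \<Longrightarrow> bracket x x = \<zero>\<^bsub>L\<^esub>"
    and jacobi: "\<lbrakk>x \<in> carrier L; y \<in> carrier L; z \<in> carrier L\<rbrakk> \<Longrightarrow>
      bracket x (bracket y z) \<oplus>\<^bsub>L\<^esub> bracket y (bracket z x) \<oplus>\<^bsub>L\<^esub> bracket z (bracket x y) = \<zero>\<^bsub>L\<^esub>"

locale three_graded_lie_algebra = lie_algebra L bracket
  for L :: "('k::comm_ring_1, 'l) module" (structure)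
    and bracket :: "'l \<Rightarrow> 'l \<Rightarrow> 'l" +
  fixes part :: "int \<Rightarrow> 'l set"
  assumes part_submodule: "submodule (part i) base_ring L"
    and part_trivial: "\<bar>i\<bar> > 1 \<Longrightarrow> part i = {\<zero>\<^bsub>L\<^esub>}"
    and part_direct_sum: "x \<in> carrier L \<Longrightarrow>
      \<exists>!(u, v, w). u \<in> part (- 1) \<and> v \<in> part 0 \<and> w \<in> part 1 \<and> x = u \<oplus>\<^bsub>L\<^esub> v \<oplus>\<^bsub>L\<^esub> w"
    and part_bracket: "\<lbrakk>x \<in> part i; y \<in> part j\<rbrakk> \<Longrightarrow> bracket x y \<in> part (i + j)"


section \<open>Jordan algebras and the module \<open>\<langle>J, J\<rangle>\<close>\<close>

locale jordan_algebra = Modules.module scale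
  for scale :: "'k::comm_ring_1 \<Rightarrow> 'j::ab_group_add \<Rightarrow> 'j" +
  fixes jmult :: "'j \<Rightarrow> 'j \<Rightarrow> 'j" (infixl \<open>\<bullet>\<close> 70)
  assumes jmult_bilinear: "bilinear_on (module_of scale) (module_of scale) (module_of scale) jmult"
    and jmult_commute: "a \<bullet> b = b \<bullet> a"
    and jordan_identity: "((a \<bullet> a) \<bullet> b) \<bullet> a = (a \<bullet> a) \<bullet> (b \<bullet> a)"

locale unital_jordan_algebra = jordan_algebra +
  fixes unit :: 'b
  assumes unit_left: "jmult unit a = a"
    and unit_right: "jmult a unit = a"

definition triple :: "('j::ab_group_add \<Rightarrow> 'j \<Rightarrow> 'j) \<Rightarrow> 'j \<Rightarrow> 'j \<Rightarrow> 'j \<Rightarrow> 'j"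
  where "triple jmult a b c = jmult (jmult a b) c + jmult a (jmult b c) - jmult b (jmult c a)"

type_synonym ('k, 'j) jj = "('j \<times> 'j \<Rightarrow>\<^sub>0 'k) set set"

definition jj_kernel ::
  "('k::comm_ring_1 \<Rightarrow> 'j::ab_group_add \<Rightarrow> 'j) \<Rightarrow> ('j \<Rightarrow> 'j \<Rightarrow> 'j) \<Rightarrow> 'j
    \<Rightarrow> ('j \<times> 'j \<Rightarrow>\<^sub>0 'k) set set"
  where "jj_kernel scale jmult unit =
    module_span base_ring (tensor_module scale scale)
      {tensor scale scale (jmult a a) a
         \<ominus>\<^bsub>tensor_module scale scale\<^esub> tensor scale scale unit (jmult (jmult a a) a) | a. True}"

definition jj_module ::
  "('k::comm_ring_1 \<Rightarrow> 'j::ab_group_add \<Rightarrow> 'j) \<Rightarrow> ('j \<Rightarrow> 'j \<Rightarrow> 'j) \<Rightarrow> 'j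
    \<Rightarrow> ('k, ('k, 'j) jj) module"
  where "jj_module scale jmult unit =
    quotient_module (tensor_module scale scale) (jj_kernel scale jmult unit)"

definition jj ::
  "('k::comm_ring_1 \<Rightarrow> 'j::ab_group_add \<Rightarrow> 'j) \<Rightarrow> ('j \<Rightarrow> 'j \<Rightarrow> 'j) \<Rightarrow> 'j
    \<Rightarrow> 'j \<Rightarrow> 'j \<Rightarrow> ('k, 'j) jj"
  where "jj scale jmult unit a b =
    jj_kernel scale jmult unit +>\<^bsub>tensor_module scale scale\<^esub> tensor scale scale a b"


section \<open>The algebra \<open>TKK(J)\<close>\<close>

text \<open>
  The products \<open>U c\<close> for \<open>c \<in> J\<^sub>-\<close>, \<open>U d\<close> for \<open>d \<in> J\<^sub>+\<close> and \<open>[U, V]\<close> are given on the generators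
  \<open>\<langle>a, b\<rangle>\<close> and extended linearly. The following predicate says that \<open>act_minus\<close>, \<open>act_plus\<close>, \<open>com\<close>
  are such extensions; that they exist is the well-definedness of these products, and on the
  carriers they are unique because the \<open>\<langle>a, b\<rangle>\<close> span \<open>\<langle>J, J\<rangle>\<close>.
\<close>

definition tkk_products ::
  "('k::comm_ring_1 \<Rightarrow> 'j::ab_group_add \<Rightarrow> 'j) \<Rightarrow> ('j \<Rightarrow> 'j \<Rightarrow> 'j) \<Rightarrow> 'j
    \<Rightarrow> (('k, 'j) jj \<Rightarrow> 'j \<Rightarrow> 'j) \<Rightarrow> (('k, 'j) jj \<Rightarrow> 'j \<Rightarrow> 'j)
    \<Rightarrow> (('k, 'j) jj \<Rightarrow> ('k, 'j) jj \<Rightarrow> ('k, 'j) jj) \<Rightarrow> bool"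
  where "tkk_products scale jmult unit act_minus act_plus com \<longleftrightarrow>
    (let J = module_of scale; Q = jj_module scale jmult unit; br = jj scale jmult unit;
         tr = triple jmult in
      bilinear_on Q J J act_minus \<and> (\<forall>a b c. act_minus (br a b) c = tr a b c) \<and>
      bilinear_on Q J J act_plus \<and> (\<forall>a b d. act_plus (br a b) d = - tr b a d) \<and>
      bilinear_on Q Q Q com \<and>
      (\<forall>a b c d. com (br a b) (br c d) = br (tr a b c) d \<ominus>\<^bsub>Q\<^esub> br c (tr b a d)))"

definition tkk_module ::
  "('k::comm_ring_1 \<Rightarrow> 'j::ab_group_add \<Rightarrow> 'j) \<Rightarrow> ('j \<Rightarrow> 'j \<Rightarrow> 'j) \<Rightarrow> 'j
    \<Rightarrow> ('k, 'j \<times> ('k, 'j) jj \<times> 'j) module"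
  where "tkk_module scale jmult unit =
    (let Q = jj_module scale jmult unit in
      \<lparr>carrier = UNIV \<times> carrier Q \<times> UNIV, monoid.mult = undefined, monoid.one = undefined,
       zero = (0, \<zero>\<^bsub>Q\<^esub>, 0),
       add = (\<lambda>(a, U, b) (c, V, d). (a + c, U \<oplus>\<^bsub>Q\<^esub> V, b + d)),
       module.smult = (\<lambda>r (a, U, b). (scale r a, r \<odot>\<^bsub>Q\<^esub> U, scale r b))\<rparr>)"

definition tkk_bracket ::
  "('k::comm_ring_1 \<Rightarrow> 'j::ab_group_add \<Rightarrow> 'j) \<Rightarrow> ('j \<Rightarrow> 'j \<Rightarrow> 'j) \<Rightarrow> 'j
    \<Rightarrow> (('k, 'j) jj \<Rightarrow> 'j \<Rightarrow> 'j) \<Rightarrow> (('k, 'j) jj \<Rightarrow> 'j \<Rightarrow> 'j)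
    \<Rightarrow> (('k, 'j) jj \<Rightarrow> ('k, 'j) jj \<Rightarrow> ('k, 'j) jj)
    \<Rightarrow> 'j \<times> ('k, 'j) jj \<times> 'j \<Rightarrow> 'j \<times> ('k, 'j) jj \<times> 'j \<Rightarrow> 'j \<times> ('k, 'j) jj \<times> 'j"
  where "tkk_bracket scale jmult unit act_minus act_plus com =
    (let Q = jj_module scale jmult unit; br = jj scale jmult unit in
      (\<lambda>(a, U, b) (c, V, d).
        (act_minus U c - act_minus V a,
         com U V \<oplus>\<^bsub>Q\<^esub> br a d \<ominus>\<^bsub>Q\<^esub> br c b,
         act_plus U d - act_plus V b)))"

definition tkk_component ::
  "('k::comm_ring_1 \<Rightarrow> 'j::ab_group_add \<Rightarrow> 'j) \<Rightarrow> ('j \<Rightarrow> 'j \<Rightarrow> 'j) \<Rightarrow> 'j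
    \<Rightarrow> int \<Rightarrow> ('j \<times> ('k, 'j) jj \<times> 'j) set"
  where "tkk_component scale jmult unit i =
    (let Q = jj_module scale jmult unit in
      if i = - 1 then UNIV \<times> {\<zero>\<^bsub>Q\<^esub>} \<times> {0}
      else if i = 0 then {0} \<times> carrier Q \<times> {0}
      else if i = 1 then {0} \<times> {\<zero>\<^bsub>Q\<^esub>} \<times> UNIV
      else {(0, \<zero>\<^bsub>Q\<^esub>, 0)})"


section \<open>Torsion\<close>

text \<open>
  That the ring \<open>k\<close> itself has no \<open>2\<close>- or \<open>3\<close>-torsion does not make \<open>\<langle>J, J\<rangle>\<close> free of \<open>2\<close>-torsion, and
  without the latter \<open>[X, Y] = - [Y, X]\<close> can fail in \<open>\<langle>J, J\<rangle>\<close>. Take \<open>k = \<int>\<close>, \<open>J = \<int>[t]/(t\<^sup>3)\<close> and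
  \<open>X = Y = \<langle>1, t\<rangle>\<close>: then \<open>[X, X] = \<langle>t, t\<rangle> - \<langle>1, t\<^sup>2\<rangle>\<close>, and with \<open>y\<^sub>i\<close> the coefficient of \<open>t\<^sup>i\<close> in \<open>y\<close>,
  the map \<open>y \<otimes> z \<mapsto> y\<^sub>1 (z\<^sub>0 + z\<^sub>1) mod 4\<close> sends \<open>a\<^sup>2 \<otimes> a - 1 \<otimes> a\<^sup>3\<close> to
  \<open>2 a\<^sub>0 a\<^sub>1 (a\<^sub>0 + a\<^sub>1) = 0\<close>, so factors through \<open>\<langle>J, J\<rangle>\<close>, but sends \<open>2 [X, X]\<close> to \<open>2 \<noteq> 0\<close>.
  Hence absence of \<open>2\<close>-torsion has to be required of \<open>\<langle>J, J\<rangle>\<close> as well. This is automatic if \<open>2\<close> is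
  invertible in \<open>k\<close>, as \<open>jj_no_two_torsion_if_invertible\<close> below shows.
\<close>

definition jj_no_two_torsion ::
  "('k::comm_ring_1 \<Rightarrow> 'j::ab_group_add \<Rightarrow> 'j) \<Rightarrow> ('j \<Rightarrow> 'j \<Rightarrow> 'j) \<Rightarrow> 'j \<Rightarrow> bool"
  where "jj_no_two_torsion scale jmult unit \<longleftrightarrow>
    (let Q = jj_module scale jmult unit in
      \<forall>U\<in>carrier Q. U \<oplus>\<^bsub>Q\<^esub> U = \<zero>\<^bsub>Q\<^esub> \<longrightarrow> U = \<zero>\<^bsub>Q\<^esub>)"

lemma cring_base: "cring (base_ring :: 'k::comm_ring_1 ring)" by (rule cring_from_type_algebra)

lemma span_submodule:
  assumes "Module.module R M" "S \<subseteq> carrier M"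
  shows "submodule (module_span R M S) R M" "S \<subseteq> module_span R M S"
proof -
  interpret Module.module R M by fact
  have c: "submodule (carrier M) R M"
    by (rule submoduleI) auto
  show "submodule (module_span R M S) R M"
  proof (rule submoduleI)
    show "module_span R M S \<subseteq> carrier M" using c assms(2) by (auto simp: module_span_def)
  qed (auto simp: module_span_def submodule_def subgroup.one_closed[where G="add_monoid M", simplified]
      subgroup.m_closed[where G="add_monoid M", simplified] subgroup.m_inv_closed[where G="add_monoid M", simplified]
      a_inv_def submodule_axioms_def)
  show "S \<subseteq> module_span R M S" by (auto simp: module_span_def)
qed

lemma quotient_is_module:
  assumes "Module.module R M" "submodule N R M"
  shows "Module.module R (quotient_module M N)"
    and "x \<in> carrier M \<Longrightarrow> c \<in> carrier R \<Longrightarrow>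
      c \<odot>\<^bsub>quotient_module M N\<^esub> (N +>\<^bsub>M\<^esub> x) = N +>\<^bsub>M\<^esub> (c \<odot>\<^bsub>M\<^esub> x)"
proof -
  interpret Module.module R M by fact
  have "additive_subgroup N M" using assms(2) by (auto simp: submodule_def additive_subgroup_def)
  then interpret N: abelian_subgroup N M by (intro abelian_subgroupI3 abelian_group_axioms)
  let ?Q = "quotient_module M N"
  have sm: "c \<odot>\<^bsub>?Q\<^esub> (N +>\<^bsub>M\<^esub> x) = N +>\<^bsub>M\<^esub> (c \<odot>\<^bsub>M\<^esub> x)"
    if "x \<in> carrier M" "c \<in> carrier R" for c x
  proof -
    have const: "N +>\<^bsub>M\<^esub> (c \<odot>\<^bsub>M\<^esub> y) = N +>\<^bsub>M\<^esub> (c \<odot>\<^bsub>M\<^esub> x)" if y: "y \<in> N +>\<^bsub>M\<^esub> x" for y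
    proof -
      obtain n where n: "n \<in> N" "y = n \<oplus>\<^bsub>M\<^esub> x" using y by (auto simp: a_r_coset_def')
      have "c \<odot>\<^bsub>M\<^esub> n \<in> N" using assms(2) n \<open>c \<in> carrier R\<close>
        by (simp add: submodule.smult_closed)
      moreover have "c \<odot>\<^bsub>M\<^esub> y = c \<odot>\<^bsub>M\<^esub> n \<oplus>\<^bsub>M\<^esub> c \<odot>\<^bsub>M\<^esub> x"
        using n that(1) \<open>x \<in> carrier M\<close> \<open>c \<in> carrier R\<close> N.a_Hcarr by (simp add: smult_r_distr)
      ultimately have "c \<odot>\<^bsub>M\<^esub> y \<in> N +>\<^bsub>M\<^esub> (c \<odot>\<^bsub>M\<^esub> x)" by (auto simp: a_r_coset_def')
      then show ?thesis using a_repr_independence \<open>x \<in> carrier M\<close> \<open>c \<in> carrier R\<close>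
        by (metis N.a_subgroup smult_closed)
    qed
    have "N +>\<^bsub>M\<^esub> x \<noteq> {}" using that N.a_rcos_self by blast
    then have "(\<Union>y\<in>N +>\<^bsub>M\<^esub> x. N +>\<^bsub>M\<^esub> (c \<odot>\<^bsub>M\<^esub> y)) = N +>\<^bsub>M\<^esub> (c \<odot>\<^bsub>M\<^esub> x)"
      by (rule SUP_eq_const) (rule const)
    then show ?thesis by (simp only: quotient_module_def module.simps)
  qed
  then show "x \<in> carrier M \<Longrightarrow> c \<in> carrier R \<Longrightarrow>
      c \<odot>\<^bsub>?Q\<^esub> (N +>\<^bsub>M\<^esub> x) = N +>\<^bsub>M\<^esub> (c \<odot>\<^bsub>M\<^esub> x)" by simp
  have car: "carrier ?Q = (\<lambda>x. N +>\<^bsub>M\<^esub> x) ` carrier M"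
    by (auto simp: quotient_module_def A_RCOSETS_def')
  have ad: "(N +>\<^bsub>M\<^esub> x) \<oplus>\<^bsub>?Q\<^esub> (N +>\<^bsub>M\<^esub> y) = N +>\<^bsub>M\<^esub> (x \<oplus>\<^bsub>M\<^esub> y)"
    if "x \<in> carrier M" "y \<in> carrier M" for x y
    using N.a_rcos_sum[OF that] by (simp add: quotient_module_def)
  have ze: "\<zero>\<^bsub>?Q\<^esub> = N +>\<^bsub>M\<^esub> \<zero>\<^bsub>M\<^esub>"
    using a_coset_add_zero[OF N.a_subset] by (simp add: quotient_module_def)
  have ab: "abelian_group ?Q"
  proof (rule abelian_groupI)
    fix A assume "A \<in> carrier ?Q"
    then obtain x where x: "x \<in> carrier M" "A = N +>\<^bsub>M\<^esub> x" by (auto simp: car)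
    have "(N +>\<^bsub>M\<^esub> (\<ominus>\<^bsub>M\<^esub> x)) \<oplus>\<^bsub>?Q\<^esub> A = \<zero>\<^bsub>?Q\<^esub>" using x by (simp add: ad ze M.l_neg)
    then show "\<exists>B\<in>carrier ?Q. B \<oplus>\<^bsub>?Q\<^esub> A = \<zero>\<^bsub>?Q\<^esub>" using x car by blast
  qed (auto simp: car ad ze M.a_ac)
  show "Module.module R ?Q"
  proof (rule module.intro[OF is_cring ab], rule module_axioms.intro)
    fix a b A B
    assume ab: "a \<in> carrier R" "b \<in> carrier R" and "A \<in> carrier ?Q" "B \<in> carrier ?Q"
    then obtain x y where xy: "x \<in> carrier M" "y \<in> carrier M"
      and A: "A = N +>\<^bsub>M\<^esub> x" and B: "B = N +>\<^bsub>M\<^esub> y" by (auto simp only: car)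
    show "(a \<oplus>\<^bsub>R\<^esub> b) \<odot>\<^bsub>?Q\<^esub> A = a \<odot>\<^bsub>?Q\<^esub> A \<oplus>\<^bsub>?Q\<^esub> b \<odot>\<^bsub>?Q\<^esub> A"
      unfolding A using ab xy by (simp only: sm ad smult_l_distr smult_closed R.a_closed)
    show "a \<odot>\<^bsub>?Q\<^esub> (A \<oplus>\<^bsub>?Q\<^esub> B) = a \<odot>\<^bsub>?Q\<^esub> A \<oplus>\<^bsub>?Q\<^esub> a \<odot>\<^bsub>?Q\<^esub> B"
      unfolding A B using ab xy by (simp only: sm ad smult_r_distr smult_closed M.a_closed)
    show "(a \<otimes>\<^bsub>R\<^esub> b) \<odot>\<^bsub>?Q\<^esub> A = a \<odot>\<^bsub>?Q\<^esub> (b \<odot>\<^bsub>?Q\<^esub> A)"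
      unfolding A using ab xy by (simp only: sm smult_assoc1 smult_closed R.m_closed)
  next
    fix a A assume a: "a \<in> carrier R" and "A \<in> carrier ?Q"
    then obtain x where x: "x \<in> carrier M" and A: "A = N +>\<^bsub>M\<^esub> x" by (auto simp only: car)
    show "a \<odot>\<^bsub>?Q\<^esub> A \<in> carrier ?Q"
      unfolding A sm[OF x a] car using a x by (intro imageI smult_closed)
  next
    fix A assume "A \<in> carrier ?Q"
    then obtain x where x: "x \<in> carrier M" and A: "A = N +>\<^bsub>M\<^esub> x" by (auto simp only: car)
    show "\<one>\<^bsub>R\<^esub> \<odot>\<^bsub>?Q\<^esub> A = A"
      unfolding A using x by (simp only: sm smult_one R.one_closed)
  qed
qed

lemma module_of_module:
  assumes "Modules.module s" shows "Module.module base_ring (module_of s)"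
proof -
  interpret Modules.module s by fact
  have "abelian_group (module_of s)"
    by (rule abelian_groupI) (auto simp: module_of_def ac_simps intro: exI[of _ "- x" for x])
  then show ?thesis
    by (intro module.intro module_axioms.intro cring_base)
      (auto simp: module_of_def ring_of_type_algebra_def scale_left_distrib scale_right_distrib)
qed

lemma free_module: "Modules.module (free_scale :: 'k::comm_ring_1 \<Rightarrow> _)"
proof -
  have [simp]: "Poly_Mapping.lookup (free_scale c x) b = c * Poly_Mapping.lookup x b" for c :: 'k and x :: "'b \<Rightarrow>\<^sub>0 'k" and b
    by (auto simp: free_scale_def Poly_Mapping.map.rep_eq when_def)
  show ?thesis
    by (rule Modules.module.intro) (auto intro!: poly_mapping_eqI simp: lookup_add algebra_simps)
qed

lemma tensor_is_module: "Module.module base_ring (tensor_module s t)"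
  unfolding tensor_module_def tensor_kernel_def
  by (intro quotient_is_module span_submodule module_of_module free_module) (simp add: module_of_def)

lemma tensor_carrier: "tensor s t a b \<in> carrier (tensor_module s t)"
  unfolding tensor_module_def tensor_def quotient_module_def
  by (auto simp: A_RCOSETS_def' module_of_def)

lemma jj_is_module: "Module.module base_ring (jj_module s m e)"
proof -
  interpret Module.module base_ring "tensor_module s s" by (rule tensor_is_module)
  show ?thesis
    unfolding jj_module_def jj_kernel_def
  proof (intro quotient_is_module(1) span_submodule(1) tensor_is_module subsetI)
    fix t assume "t \<in> {tensor s s (m a a) a \<ominus>\<^bsub>tensor_module s s\<^esub> tensor s s e (m (m a a) a) | a. True}"
    then show "t \<in> carrier (tensor_module s s)" by (elim CollectE exE conjE) (simp only: M.minus_closed tensor_carrier)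
  qed
qed

lemma two_invertible:
  assumes "2 * h = (1::'k::comm_ring_1)"
    and "U \<in> carrier (jj_module (s :: 'k \<Rightarrow> 'j::ab_group_add \<Rightarrow> 'j) m e)"
    and "U \<oplus>\<^bsub>jj_module s m e\<^esub> U = \<zero>\<^bsub>jj_module s m e\<^esub>"
  shows "U = \<zero>\<^bsub>jj_module s m e\<^esub>"
proof -
  interpret Module.module base_ring "jj_module s m e" by (rule jj_is_module)
  let ?Q = "jj_module s m e"
  have "h + h = 1" using assms(1) by (simp only: mult_2)
  then have "U = (h + h) \<odot>\<^bsub>?Q\<^esub> U" using smult_one[of U] assms(2) by (simp add: ring_of_type_algebra_def)
  also have "\<dots> = h \<odot>\<^bsub>?Q\<^esub> U \<oplus>\<^bsub>?Q\<^esub> h \<odot>\<^bsub>?Q\<^esub> U"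
    using smult_l_distr[of h h U] assms(2) by (simp add: ring_of_type_algebra_def)
  also have "\<dots> = h \<odot>\<^bsub>?Q\<^esub> (U \<oplus>\<^bsub>?Q\<^esub> U)"
    using smult_r_distr[of h U U] assms(2) by (simp add: ring_of_type_algebra_def)
  also have "\<dots> = \<zero>\<^bsub>?Q\<^esub>"
    unfolding assms(3) by (rule smult_r_null) (simp add: ring_of_type_algebra_def)
  finally show ?thesis .
qed

lemma jj_no_two_torsion_if_invertible:
  assumes "2 * h = (1::'k::comm_ring_1)"
  shows "jj_no_two_torsion (s :: 'k \<Rightarrow> 'j::ab_group_add \<Rightarrow> 'j) m e"
  using two_invertible[OF assms] by (auto simp: jj_no_two_torsion_def Let_def)

end

theory Submission
  imports Defs
begin

text \<open>
  Write \<open>L\<^sub>x\<close> for multiplication by \<open>x\<close> in \<open>J\<close> and \<open>D\<close> for an inner derivation, that is, a linear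
  combination of commutators \<open>[L\<^sub>a, L\<^sub>b]\<close>. Since \<open>{a, b, c} = L\<^sub>a\<^sub>b c + [L\<^sub>a, L\<^sub>b] c\<close>, an element \<open>X\<close> of \<open>\<langle>J, J\<rangle>\<close>
  acts on \<open>J\<^sub>-\<close> by \<open>D + L\<^sub>x\<close> and on \<open>J\<^sub>+\<close> by \<open>D - L\<^sub>x\<close>, where \<open>x\<close> is the image of \<open>X\<close> under multiplication
  \<open>\<langle>a, b\<rangle> \<mapsto> ab\<close>. The rule for the bracket on \<open>\<langle>J, J\<rangle>\<close> then reads
  \<open>[X, \<langle>c, d\<rangle>] = \<langle>Xc, d\<rangle> + \<langle>c, Xd\<rangle>\<close>, so every identity about generators \<open>X\<close> becomes one about all \<open>X\<close>
  of the form \<open>(D + L\<^sub>x, D - L\<^sub>x)\<close>. Three facts carry the proof.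

  First, \<open>[X, Y]\<close> acts as the commutator of the actions of \<open>X\<close> and \<open>Y\<close> (\<open>act_com\<close>). This is the
  derivation identity of the triple product, \<open>act_tr\<close>, which rests on the linearized Jordan identity:
  the latter says both that \<open>[L\<^sub>a, L\<^sub>b]\<close> is a derivation and that \<open>[L\<^sub>a\<^sub>b, L\<^sub>c]\<close> vanishes when summed
  cyclically.

  Second, the bracket respects the relations of \<open>\<langle>J, J\<rangle>\<close> (\<open>com_null_left\<close>, \<open>com_null_right\<close>) and is
  skew-symmetric (\<open>com_skew\<close>). Put \<open>\<delta>(a, b) = \<langle>a, b\<rangle> - \<langle>1, ab\<rangle>\<close> (below: \<open>skew\<close>). Polarizing
  \<open>\<langle>a\<^sup>2, a\<rangle> = \<langle>1, a\<^sup>3\<rangle>\<close> gives \<open>\<delta>(ab, c) + \<delta>(bc, a) + \<delta>(ca, b) = 0\<close>, hence \<open>\<delta>(a, b) = - \<delta>(b, a)\<close>.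
  Both skew-symmetry and compatibility with the cubic relation separate into a part in the \<open>\<delta>\<close>s, which
  follows from these two identities, and a part \<open>\<langle>1, y\<rangle>\<close> with \<open>y = 0\<close> by the Jordan identity.
  Skew-symmetry gives \<open>[X, X] = 0\<close> because \<open>\<langle>J, J\<rangle>\<close> has no \<open>2\<close>-torsion.

  Third, every \<open>[X, -]\<close> is a derivation of the bracket on \<open>\<langle>J, J\<rangle>\<close> (\<open>com_derivation\<close>): on \<open>\<langle>c, d\<rangle>\<close> this is
  the first fact applied to \<open>c\<close> and to \<open>d\<close>. With skew-symmetry it is the Jacobi identity there. In
  the components of degree \<open>-1\<close> and \<open>1\<close> the Jacobi identity is the first fact together with
  \<open>{a, b, c} = {c, b, a}\<close>.

  Cancelling \<open>2\<close> in \<open>J\<close>, needed to linearize the Jordan identity, is legitimate: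
  \<open>a \<mapsto> \<langle>1, a\<rangle>\<close> is injective, with left inverse given by multiplication, so \<open>J\<close> inherits the absence of \<open>2\<close>-torsion.

  The computations take place in the free module on \<open>J \<times> J\<close>, whose type is an abelian group, modulo
  the submodule \<open>jj_null\<close> of relations; \<open>jj_class_eq_zero_iff\<close> identifies that quotient with \<open>\<langle>J, J\<rangle>\<close>.
\<close>

section \<open>Free modules and linear extension\<close>

definition linear_extension ::
  "('k::comm_ring_1 \<Rightarrow> 'm::ab_group_add \<Rightarrow> 'm) \<Rightarrow> ('p \<Rightarrow> 'm) \<Rightarrow> ('p \<Rightarrow>\<^sub>0 'k) \<Rightarrow> 'm"
  where "linear_extension s g f =
    (\<Sum>p\<in>Poly_Mapping.keys f. s (Poly_Mapping.lookup f p) (g p))"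

lemma lookup_free_scale [simp]:
  "Poly_Mapping.lookup (free_scale c f) p = c * Poly_Mapping.lookup f p"
  by (auto simp: free_scale_def Poly_Mapping.map.rep_eq when_def)

interpretation free: Modules.module free_scale
  by (rule free_module)

lemma free_scale_single:
  "free_scale c (Poly_Mapping.single p d) = Poly_Mapping.single p (c * d)"
  by (rule poly_mapping_eqI) (simp add: lookup_single when_def)

context Modules.module
begin

lemma linear_extension_superset:
  assumes "finite A" "Poly_Mapping.keys f \<subseteq> A"
  shows "linear_extension scale g f = (\<Sum>p\<in>A. scale (Poly_Mapping.lookup f p) (g p))"
  unfolding linear_extension_def
  by (rule sum.mono_neutral_left) (use assms in \<open>auto simp: in_keys_iff\<close>)

lemma linear_extension_add:
  "linear_extension scale g (f + f') = linear_extension scale g f + linear_extension scale g f'"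
proof -
  let ?A = "Poly_Mapping.keys f \<union> Poly_Mapping.keys f'"
  have "Poly_Mapping.keys (f + f') \<subseteq> ?A" by (rule Poly_Mapping.keys_add)
  then show ?thesis
    by (simp add: linear_extension_superset[of ?A] lookup_add scale_left_distrib sum.distrib)
qed

lemma linear_extension_scale:
  "linear_extension scale g (free_scale c f) = scale c (linear_extension scale g f)"
proof -
  have "Poly_Mapping.keys (free_scale c f) \<subseteq> Poly_Mapping.keys f" by (auto simp: in_keys_iff)
  then show ?thesis
    by (simp add: linear_extension_superset[of "Poly_Mapping.keys f"] scale_sum_right)
qed

lemma linear_extension_single [simp]: "linear_extension scale g (Poly_Mapping.single p 1) = g p"
  by (simp add: linear_extension_def)

end

lemma free_module_induct [case_names pure add scale]:
  fixes U :: "'a \<times> 'b \<Rightarrow>\<^sub>0 'k::comm_ring_1"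
  assumes pure: "\<And>a b. P (pure a b)"
    and add: "\<And>U V. P U \<Longrightarrow> P V \<Longrightarrow> P (U + V)"
    and scale: "\<And>c U. P U \<Longrightarrow> P (free_scale c U)"
  shows "P U"
proof (induction U rule: update_induct)
  case const
  have "(0 :: 'a \<times> 'b \<Rightarrow>\<^sub>0 'k) = free_scale 0 (pure undefined undefined)" by simp
  then show ?case using scale pure by metis
next
  case (update f p c)
  \<comment> \<open>The induction rule inserts a key that is not yet present, so updating adds a monomial.\<close>
  have "Poly_Mapping.update p c f = f + free_scale c (pure (fst p) (snd p))"
    using update.hyps by (intro poly_mapping_eqI)
      (auto simp: free_scale_single lookup_add lookup_update lookup_single when_def in_keys_iff)
  then show ?case using add[OF update.IH scale[OF pure]] by metis
qed

section \<open>Polarization\<close>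

text \<open>
  A trilinear map that vanishes on the diagonal has vanishing symmetrization. Everything is taken
  modulo \<open>K\<close>, so that the lemma serves both for identities in an algebra (\<open>K = {0}\<close>) and for
  consequences of the relations \<open>jj_null\<close>.
\<close>

lemma cubic_polarization:
  fixes t :: "'a::ab_group_add \<Rightarrow> 'a \<Rightarrow> 'a \<Rightarrow> 'm::ab_group_add"
  assumes K_add: "\<And>x y. x \<in> K \<Longrightarrow> y \<in> K \<Longrightarrow> x + y \<in> K"
    and K_diff: "\<And>x y. x \<in> K \<Longrightarrow> y \<in> K \<Longrightarrow> x - y \<in> K"
    and add1: "\<And>a a' b c. t (a + a') b c - t a b c - t a' b c \<in> K"
    and add2: "\<And>a b b' c. t a (b + b') c - t a b c - t a b' c \<in> K"
    and add3: "\<And>a b c c'. t a b (c + c') - t a b c - t a b c' \<in> K"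
    and cube: "\<And>a. t a a a \<in> K"
  shows "t a b c + t a c b + t b a c + t b c a + t c a b + t c b a \<in> K"
proof -
  \<comment> \<open>The part of \<open>t (x + y) (x + y) (x + y)\<close> that is quadratic in \<open>x\<close> and linear in \<open>y\<close>.\<close>
  define s where "s x y = t x x y + t x y x + t y x x" for x y
  have s: "s x y + s y x \<in> K" for x y
  proof -
    have "s x y + s y x = t (x + y) (x + y) (x + y) - t x x x - t y y y
      - (t (x + y) (x + y) (x + y) - t x (x + y) (x + y) - t y (x + y) (x + y))
      - (t x (x + y) (x + y) - t x x (x + y) - t x y (x + y))
      - (t y (x + y) (x + y) - t y x (x + y) - t y y (x + y))
      - (t x x (x + y) - t x x x - t x x y) - (t x y (x + y) - t x y x - t x y y)
      - (t y x (x + y) - t y x x - t y x y) - (t y y (x + y) - t y y x - t y y y)"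
      by (simp add: s_def)
    also have "\<dots> \<in> K" by (intro K_diff cube add1 add2 add3)
    finally show ?thesis .
  qed
  \<comment> \<open>Linearize \<open>s x y + s y x\<close> in \<open>x = a + b\<close>: the summand \<open>s y x\<close> is additive in \<open>x\<close> and cancels.\<close>
  have "t a b c + t a c b + t b a c + t b c a + t c a b + t c b a =
    (s (a + b) c + s c (a + b)) - (s a c + s c a) - (s b c + s c b)
    - (t (a + b) (a + b) c - t a (a + b) c - t b (a + b) c)
    - (t a (a + b) c - t a a c - t a b c) - (t b (a + b) c - t b a c - t b b c)
    - (t (a + b) c (a + b) - t a c (a + b) - t b c (a + b))
    - (t a c (a + b) - t a c a - t a c b) - (t b c (a + b) - t b c a - t b c b)
    - (t c (a + b) (a + b) - t c a (a + b) - t c b (a + b))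
    - (t c a (a + b) - t c a a - t c a b) - (t c b (a + b) - t c b a - t c b b)
    - (t c c (a + b) - t c c a - t c c b)
    - (t c (a + b) c - t c a c - t c b c)
    - (t (a + b) c c - t a c c - t b c c)"
    by (simp add: s_def)
  also have "\<dots> \<in> K" by (intro K_diff s add1 add2 add3)
  finally show ?thesis .
qed

section \<open>The relations of \<open>\<langle>J, J\<rangle>\<close>\<close>

text \<open>
  The submodule of relations of \<open>\<langle>J, J\<rangle>\<close>, generated in one go rather than as the relations of the tensor
  product followed by those of its quotient. The inductive form makes proofs that a linear map
  kills all relations into rule inductions.
\<close>

inductive_set jj_null ::
  "('k::comm_ring_1 \<Rightarrow> 'j::ab_group_add \<Rightarrow> 'j) \<Rightarrow> ('j \<Rightarrow> 'j \<Rightarrow> 'j) \<Rightarrow> 'j \<Rightarrow> ('j \<times> 'j \<Rightarrow>\<^sub>0 'k) set"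
  for s m e where
  null_add: "f \<in> jj_null s m e \<Longrightarrow> g \<in> jj_null s m e \<Longrightarrow> f + g \<in> jj_null s m e"
| null_scale: "f \<in> jj_null s m e \<Longrightarrow> free_scale c f \<in> jj_null s m e"
| pure_add_left: "pure (a + a') b - pure a b - pure a' b \<in> jj_null s m e"
| pure_add_right: "pure a (b + b') - pure a b - pure a b' \<in> jj_null s m e"
| pure_scale_left: "pure (s c a) b - free_scale c (pure a b) \<in> jj_null s m e"
| pure_scale_right: "pure a (s c b) - free_scale c (pure a b) \<in> jj_null s m e"
| cube: "pure (m a a) a - pure e (m (m a a) a) \<in> jj_null s m e"

section \<open>Jordan identities\<close>

context jordan_algebra begin

lemma jmult_add_left: "(a + a') \<bullet> b = a \<bullet> b + a' \<bullet> b"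
  and jmult_add_right: "a \<bullet> (b + b') = a \<bullet> b + a \<bullet> b'"
  and jmult_scale_left: "scale c a \<bullet> b = scale c (a \<bullet> b)"
  and jmult_scale_right: "a \<bullet> scale c b = scale c (a \<bullet> b)"
  using jmult_bilinear by (simp_all add: bilinear_on_def module_of_def)

lemma jmult_zero_left [simp]: "0 \<bullet> a = 0"
  using jmult_add_left[of 0 0 a] by simp

lemma jmult_zero_right [simp]: "a \<bullet> 0 = 0"
  using jmult_add_right[of a 0 0] by simp

lemma jmult_minus_left: "(- a) \<bullet> b = - (a \<bullet> b)"
  using jmult_add_left[of a "- a" b] by (simp add: eq_neg_iff_add_eq_0 add.commute)

lemma jmult_minus_right: "a \<bullet> (- b) = - (a \<bullet> b)"
  using jmult_minus_left[of b a] by (simp add: jmult_commute)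

lemma jmult_diff_left: "(a - a') \<bullet> b = a \<bullet> b - a' \<bullet> b"
  using jmult_add_left[of a "- a'" b] by (simp add: jmult_minus_left)

lemma jmult_diff_right: "a \<bullet> (b - b') = a \<bullet> b - a \<bullet> b'"
  using jmult_add_right[of a b "- b'"] by (simp add: jmult_minus_right)

lemmas jmult_linear = jmult_add_left jmult_add_right jmult_diff_left jmult_diff_right
  jmult_minus_left jmult_minus_right

text \<open>
  The inner derivation \<open>[L\<^sub>a, L\<^sub>b]\<close>.
\<close>

definition inner :: "'j \<Rightarrow> 'j \<Rightarrow> 'j \<Rightarrow> 'j" where
  "inner a b c = a \<bullet> (b \<bullet> c) - b \<bullet> (a \<bullet> c)"

abbreviation tr where "tr \<equiv> triple jmult"

lemma inner_swap: "inner b a c = - inner a b c"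
  by (simp add: inner_def)

lemma tr_eq: "tr a b c = (a \<bullet> b) \<bullet> c + inner a b c"
  by (simp add: triple_def inner_def jmult_commute)

lemma tr_outer_commute: "tr a b c = tr c b a"
  by (simp add: triple_def jmult_commute)

lemma inner_linear:
  "inner (a + a') b c = inner a b c + inner a' b c" "inner (a - a') b c = inner a b c - inner a' b c"
  "inner a (b + b') c = inner a b c + inner a b' c" "inner a (b - b') c = inner a b c - inner a b' c"
  "inner a b (c + c') = inner a b c + inner a b c'" "inner a b (c - c') = inner a b c - inner a b c'"
  by (simp_all add: inner_def jmult_linear)

lemma inner_scale:
  "inner (scale r a) b c = scale r (inner a b c)"
  "inner a (scale r b) c = scale r (inner a b c)"
  "inner a b (scale r c) = scale r (inner a b c)"
  by (simp_all add: inner_def jmult_scale_left jmult_scale_right scale_right_diff_distrib)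

lemma inner_square: "inner (a \<bullet> a) a c = 0"
  using jordan_identity[of a c] by (simp add: inner_def jmult_commute)

lemma tr_linear:
  "tr (a + a') b c = tr a b c + tr a' b c" "tr (a - a') b c = tr a b c - tr a' b c"
  "tr a (b + b') c = tr a b c + tr a b' c" "tr a (b - b') c = tr a b c - tr a b' c"
  "tr a b (c + c') = tr a b c + tr a b c'" "tr a b (c - c') = tr a b c - tr a b c'"
  by (simp_all add: triple_def jmult_linear)

end

locale jordan_algebra_no_two_torsion = jordan_algebra +
  assumes no_two_torsion: "x + x = 0 \<Longrightarrow> x = (0 :: 'b)"
begin

text \<open>
  For fixed \<open>z\<close> the map \<open>t a b c = ((ab)z)c - (ab)(zc)\<close> vanishes on the diagonal by the Jordan
  identity. It is symmetric in \<open>a\<close> and \<open>b\<close>, so its symmetrization is twice the cyclic sum.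
\<close>

lemma linearized_jordan:
  "((a \<bullet> b) \<bullet> z) \<bullet> c + ((b \<bullet> c) \<bullet> z) \<bullet> a + ((c \<bullet> a) \<bullet> z) \<bullet> b =
    (a \<bullet> b) \<bullet> (z \<bullet> c) + (b \<bullet> c) \<bullet> (z \<bullet> a) + (c \<bullet> a) \<bullet> (z \<bullet> b)"
proof -
  define t where "t a b c = ((a \<bullet> b) \<bullet> z) \<bullet> c - (a \<bullet> b) \<bullet> (z \<bullet> c)" for a b c
  have sym: "t x y w = t y x w" for x y w by (simp add: t_def jmult_commute)
  have "t a b c + t a c b + t b a c + t b c a + t c a b + t c b a \<in> {0}"
    by (rule cubic_polarization)
      (simp_all add: t_def jmult_linear jordan_identity)
  then have "(t a b c + t b c a + t c a b) + (t a b c + t b c a + t c a b) = 0"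
    by (simp add: sym add.assoc add.commute add.left_commute)
  then have "t a b c + t b c a + t c a b = 0" by (rule no_two_torsion)
  moreover have "t a b c + t b c a + t c a b =
      (((a \<bullet> b) \<bullet> z) \<bullet> c + ((b \<bullet> c) \<bullet> z) \<bullet> a + ((c \<bullet> a) \<bullet> z) \<bullet> b)
      - ((a \<bullet> b) \<bullet> (z \<bullet> c) + (b \<bullet> c) \<bullet> (z \<bullet> a) + (c \<bullet> a) \<bullet> (z \<bullet> b))"
    by (simp add: t_def)
  ultimately show ?thesis by simp
qed

text \<open>
  The right-hand side of the linearized Jordan identity, in which \<open>z\<close> stands apart from the symmetric
  variables, is invariant under all permutations of the four variables. Equating the left-hand sides
  for \<open>z = b\<close> and for \<open>z = a\<close> gives the derivation rule.
\<close>

lemma inner_derivation: "inner a b (c \<bullet> d) = inner a b c \<bullet> d + c \<bullet> inner a b d"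
proof -
  have "((c \<bullet> d) \<bullet> b) \<bullet> a + ((d \<bullet> a) \<bullet> b) \<bullet> c + ((a \<bullet> c) \<bullet> b) \<bullet> d =
      ((c \<bullet> d) \<bullet> a) \<bullet> b + ((d \<bullet> b) \<bullet> a) \<bullet> c + ((b \<bullet> c) \<bullet> a) \<bullet> d"
    unfolding linearized_jordan[of c d b a] linearized_jordan[of c d a b]
    by (simp add: jmult_commute)
  moreover have "inner a b (c \<bullet> d) - (inner a b c \<bullet> d + c \<bullet> inner a b d) =
      (((c \<bullet> d) \<bullet> b) \<bullet> a + ((d \<bullet> a) \<bullet> b) \<bullet> c + ((a \<bullet> c) \<bullet> b) \<bullet> d)
      - (((c \<bullet> d) \<bullet> a) \<bullet> b + ((d \<bullet> b) \<bullet> a) \<bullet> c + ((b \<bullet> c) \<bullet> a) \<bullet> d)"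
    by (simp add: inner_def jmult_linear jmult_commute)
  ultimately show ?thesis by simp
qed

text \<open>
  The linearized Jordan identity read as an identity of operators applied to \<open>z\<close>.
\<close>

lemma inner_cyclic: "inner (a \<bullet> b) c z + inner (b \<bullet> c) a z + inner (c \<bullet> a) b z = 0"
proof -
  have "inner (a \<bullet> b) c z + inner (b \<bullet> c) a z + inner (c \<bullet> a) b z =
      ((a \<bullet> b) \<bullet> (z \<bullet> c) + (b \<bullet> c) \<bullet> (z \<bullet> a) + (c \<bullet> a) \<bullet> (z \<bullet> b))
      - (((a \<bullet> b) \<bullet> z) \<bullet> c + ((b \<bullet> c) \<bullet> z) \<bullet> a + ((c \<bullet> a) \<bullet> z) \<bullet> b)"
    by (simp add: inner_def jmult_commute)
  then show ?thesis by (simp add: linearized_jordan)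
qed

text \<open>
  The pair \<open>(L\<^sub>x, - L\<^sub>x)\<close> is a derivation of the triple product, with \<open>- L\<^sub>x\<close> acting on the middle
  argument. After expanding \<open>{c, d, e}\<close> as \<open>(cd)e + [L\<^sub>c, L\<^sub>d] e\<close>, the first summand is treated with
  \<open>inner_cyclic\<close> and the second with \<open>inner_derivation\<close>.
\<close>

lemma tr_mult: "x \<bullet> tr c d e = tr (x \<bullet> c) d e - tr c (x \<bullet> d) e + tr c d (x \<bullet> e)"
proof -
  have "inner x (c \<bullet> d) e = inner (x \<bullet> c) d e + inner (d \<bullet> x) c e"
    using inner_cyclic[of x c d e] by (simp add: inner_swap[of "c \<bullet> d"] algebra_simps)
  then have "x \<bullet> ((c \<bullet> d) \<bullet> e) = inner (x \<bullet> c) d e - inner c (x \<bullet> d) e + (c \<bullet> d) \<bullet> (x \<bullet> e)"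
    by (simp add: inner_def jmult_commute diff_eq_eq)
  moreover have "inner c d (x \<bullet> e) = ((x \<bullet> d) \<bullet> c) \<bullet> e - ((x \<bullet> c) \<bullet> d) \<bullet> e + x \<bullet> inner c d e"
    unfolding inner_derivation by (simp add: inner_def jmult_linear jmult_commute)
  ultimately show ?thesis by (simp add: tr_eq jmult_linear jmult_commute)
qed

end

section \<open>Presentation of \<open>\<langle>J, J\<rangle>\<close> by the free module\<close>

lemma base_ring_simps [simp]:
  "carrier base_ring = UNIV" "a \<oplus>\<^bsub>base_ring\<^esub> b = a + b" "a \<otimes>\<^bsub>base_ring\<^esub> b = a * b"
  "\<one>\<^bsub>base_ring\<^esub> = 1" "\<zero>\<^bsub>base_ring\<^esub> = 0"
  by (simp_all add: ring_of_type_algebra_def)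

text \<open>
  A module given by generators. Passing to a quotient of \<open>M\<close> only replaces \<open>p\<close> (lemma \<open>quotient\<close>
  below), so that two applications present \<open>\<langle>J, J\<rangle>\<close>, a quotient of a quotient of a free module.
\<close>

locale linear_surjection = Module.module base_ring M
  for M :: "('k::comm_ring_1, 'm) module" (structure) +
  fixes p :: "('i \<Rightarrow>\<^sub>0 'k) \<Rightarrow> 'm"
  assumes map_add: "p (f + g) = p f \<oplus> p g"
    and map_scale: "p (free_scale c f) = c \<odot> p f"
    and carrier_eq: "carrier M = range p"
begin

lemma map_closed [simp]: "p f \<in> carrier M"
  by (simp add: carrier_eq)

lemma map_zero: "p 0 = \<zero>"
  using map_add[of 0 0] by (simp add: M.add.r_cancel_one')

lemma map_minus: "p (- f) = \<ominus> p f"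
  using map_add[of "- f" f] by (simp add: map_zero M.minus_equality)

lemma map_diff: "p (f - g) = p f \<ominus> p g"
  using map_add[of f "- g"] by (simp add: map_minus M.minus_eq)

lemma map_eq_iff: "p f = p g \<longleftrightarrow> p (f - g) = \<zero>"
  by (simp add: map_diff M.minus_eq) (metis M.add.inv_closed M.minus_minus M.minus_equality M.r_neg map_closed)

lemma submodule_image:
  assumes "\<And>f g. f \<in> S \<Longrightarrow> g \<in> S \<Longrightarrow> f + g \<in> S" "\<And>c f. f \<in> S \<Longrightarrow> free_scale c f \<in> S" "S \<noteq> {}"
  shows "submodule (p ` S) base_ring M"
proof (rule submoduleI)
  obtain f where "f \<in> S" using assms(3) by blast
  with assms(2)[of f 0] have "0 \<in> S" by simp
  then show "\<zero> \<in> p ` S" by (metis imageI map_zero)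
next
  fix h assume "h \<in> p ` S"
  then show "\<ominus> h \<in> p ` S" using assms(2)[of _ "- 1"] by (auto simp flip: map_minus)
qed (auto simp: assms simp flip: map_add map_scale)

lemma quotient:
  assumes "submodule N base_ring M"
  shows "linear_surjection (quotient_module M N) (\<lambda>f. N +> p f)"
    and "N +> p f = \<zero>\<^bsub>quotient_module M N\<^esub> \<longleftrightarrow> p f \<in> N"
proof -
  have "additive_subgroup N M" using assms by (auto simp: submodule_def additive_subgroup_def)
  then interpret N: abelian_subgroup N M by (intro abelian_subgroupI3 abelian_group_axioms)
  show "linear_surjection (quotient_module M N) (\<lambda>f. N +> p f)"
  proof (intro linear_surjection.intro linear_surjection_axioms.intro
      quotient_is_module(1)[OF module_axioms assms])
    show "N +> p (f + g) = (N +> p f) \<oplus>\<^bsub>quotient_module M N\<^esub> (N +> p g)" for f g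
      using N.a_rcos_sum[of "p f" "p g"] by (simp add: quotient_module_def map_add)
    show "N +> p (free_scale c f) = c \<odot>\<^bsub>quotient_module M N\<^esub> (N +> p f)" for c f
      using quotient_is_module(2)[OF module_axioms assms, of "p f" c] by (simp add: map_scale)
    show "carrier (quotient_module M N) = range (\<lambda>f. N +> p f)"
      by (auto simp: quotient_module_def A_RCOSETS_def' carrier_eq)
  qed
  show "N +> p f = \<zero>\<^bsub>quotient_module M N\<^esub> \<longleftrightarrow> p f \<in> N"
    using N.a_rcos_self[of "p f"] N.a_rcos_const[of "p f"] by (auto simp: quotient_module_def)
qed

end

lemma linear_surjection_free: "linear_surjection (module_of free_scale) (\<lambda>f. f)"
  by (intro linear_surjection.intro linear_surjection_axioms.intro module_of_module free_module)
    (simp_all add: module_of_def)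

lemma linear_surjection_tensor:
  "linear_surjection (tensor_module s t) (\<lambda>f. tensor_kernel s t +>\<^bsub>module_of free_scale\<^esub> f)"
  "tensor_kernel s t +>\<^bsub>module_of free_scale\<^esub> f = \<zero>\<^bsub>tensor_module s t\<^esub> \<longleftrightarrow> f \<in> tensor_kernel s t"
proof -
  have "submodule (tensor_kernel s t) base_ring (module_of free_scale)"
    unfolding tensor_kernel_def
    by (intro span_submodule module_of_module free_module) (simp add: module_of_def)
  then show "linear_surjection (tensor_module s t) (\<lambda>f. tensor_kernel s t +>\<^bsub>module_of free_scale\<^esub> f)"
    "tensor_kernel s t +>\<^bsub>module_of free_scale\<^esub> f = \<zero>\<^bsub>tensor_module s t\<^esub> \<longleftrightarrow> f \<in> tensor_kernel s t"
    unfolding tensor_module_def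
    by (rule linear_surjection.quotient[OF linear_surjection_free])+
qed

definition jj_class ::
  "('k::comm_ring_1 \<Rightarrow> 'j::ab_group_add \<Rightarrow> 'j) \<Rightarrow> ('j \<Rightarrow> 'j \<Rightarrow> 'j) \<Rightarrow> 'j
    \<Rightarrow> ('j \<times> 'j \<Rightarrow>\<^sub>0 'k) \<Rightarrow> ('k, 'j) jj"
  where "jj_class s m e f =
    jj_kernel s m e +>\<^bsub>tensor_module s s\<^esub> (tensor_kernel s s +>\<^bsub>module_of free_scale\<^esub> f)"

lemma jj_class_pure: "jj_class s m e (pure a b) = jj s m e a b"
  by (simp add: jj_class_def jj_def tensor_def)

lemma jj_kernel_submodule: "submodule (jj_kernel s m e) base_ring (tensor_module s s)"
  and cube_in_jj_kernel:
    "tensor s s (m a a) a \<ominus>\<^bsub>tensor_module s s\<^esub> tensor s s e (m (m a a) a) \<in> jj_kernel s m e"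
proof -
  interpret Module.module base_ring "tensor_module s s" by (rule tensor_is_module)
  have "{tensor s s (m a a) a \<ominus>\<^bsub>tensor_module s s\<^esub> tensor s s e (m (m a a) a) | a. True}
      \<subseteq> carrier (tensor_module s s)"
    using tensor_carrier by (auto intro!: M.minus_closed)
  note span = span_submodule[OF tensor_is_module this, folded jj_kernel_def]
  show "submodule (jj_kernel s m e) base_ring (tensor_module s s)" by (rule span(1))
  show "tensor s s (m a a) a \<ominus>\<^bsub>tensor_module s s\<^esub> tensor s s e (m (m a a) a) \<in> jj_kernel s m e"
    using span(2) by blast
qed

lemma linear_surjection_jj_class: "linear_surjection (jj_module s m e) (jj_class s m e)"
  unfolding jj_module_def jj_class_def[abs_def]
  by (rule linear_surjection.quotient[OF linear_surjection_tensor(1) jj_kernel_submodule])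

lemma module_span_least:
  assumes "submodule N R M" "S \<subseteq> N"
  shows "module_span R M S \<subseteq> N"
  using assms by (auto simp: module_span_def)

lemma tensor_relations_in_kernel: "tensor_relations s t \<subseteq> tensor_kernel s t"
  unfolding tensor_kernel_def
  by (intro span_submodule(2) module_of_module free_module) (simp add: module_of_def)

text \<open>
  Relations in \<open>jj_null\<close> hold in \<open>\<langle>J, J\<rangle>\<close> by rule induction. Conversely, the image of \<open>jj_null\<close> in the tensor
  product is a submodule containing the generators of \<open>jj_kernel\<close>, so a relation of \<open>\<langle>J, J\<rangle>\<close> differs from
  an element of \<open>jj_null\<close> by a relation of the tensor product, and these also lie in \<open>jj_null\<close>.
\<close>

lemma jj_class_eq_zero_iff: "jj_class s m e f = \<zero>\<^bsub>jj_module s m e\<^esub> \<longleftrightarrow> f \<in> jj_null s m e"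
proof
  let ?T = "tensor_module s s" and ?N = "jj_null s m e"
  define q where "q f = tensor_kernel s s +>\<^bsub>module_of free_scale\<^esub> f" for f
  interpret q: linear_surjection ?T q
    unfolding q_def[abs_def] by (rule linear_surjection_tensor(1))
  interpret \<pi>: linear_surjection "jj_module s m e" "jj_class s m e"
    by (rule linear_surjection_jj_class)
  have q_zero: "q f = \<zero>\<^bsub>?T\<^esub> \<longleftrightarrow> f \<in> tensor_kernel s s" for f
    unfolding q_def by (rule linear_surjection_tensor(2))
  have class_zero: "jj_class s m e f = \<zero>\<^bsub>jj_module s m e\<^esub> \<longleftrightarrow> q f \<in> jj_kernel s m e" for f
    unfolding jj_class_def jj_module_def q_def
    by (rule linear_surjection.quotient[OF linear_surjection_tensor(1) jj_kernel_submodule])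
  have null_ne: "?N \<noteq> {}" using jj_null.cube by blast
  have tensor_sub: "tensor_kernel s s \<subseteq> ?N"
    unfolding tensor_kernel_def
  proof (rule module_span_least)
    show "submodule ?N base_ring (module_of free_scale)"
      using linear_surjection.submodule_image[OF linear_surjection_free, of ?N] null_ne
      by (simp add: null_add null_scale)
    show "tensor_relations s s \<subseteq> ?N"
      by (auto simp: tensor_relations_def intro: jj_null.intros)
  qed
  have tensor_q: "tensor s s a b = q (pure a b)" for a b
    by (simp add: q_def tensor_def)
  {
    assume "jj_class s m e f = \<zero>\<^bsub>jj_module s m e\<^esub>"
    moreover have "jj_kernel s m e \<subseteq> q ` ?N"
      unfolding jj_kernel_def
    proof (rule module_span_least)
      show "submodule (q ` ?N) base_ring ?T"
        by (rule q.submodule_image) (simp_all add: null_add null_scale null_ne)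
      show "{tensor s s (m a a) a \<ominus>\<^bsub>?T\<^esub> tensor s s e (m (m a a) a) | a. True} \<subseteq> q ` ?N"
      proof
        fix u assume "u \<in> {tensor s s (m a a) a \<ominus>\<^bsub>?T\<^esub> tensor s s e (m (m a a) a) | a. True}"
        then obtain a where "u = q (pure (m a a) a - pure e (m (m a a) a))"
          by (auto simp only: tensor_q q.map_diff)
        then show "u \<in> q ` ?N" by (simp only: imageI jj_null.cube)
      qed
    qed
    ultimately have "q f \<in> q ` ?N" by (simp only: class_zero subset_iff)
    then obtain g where g: "g \<in> ?N" "q f = q g" by (elim imageE)
    then have "f - g \<in> tensor_kernel s s" by (simp only: q.map_eq_iff[of f g] q_zero)
    with tensor_sub have "f - g \<in> ?N" by (rule subsetD)
    from null_add[OF this g(1)] show "f \<in> ?N" by simp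
  next
    have tensor: "jj_class s m e f = \<zero>\<^bsub>jj_module s m e\<^esub>" if "f \<in> tensor_relations s s" for f
    proof -
      from that have "q f = \<zero>\<^bsub>?T\<^esub>" by (simp only: q_zero subsetD[OF tensor_relations_in_kernel])
      moreover have "\<zero>\<^bsub>?T\<^esub> \<in> jj_kernel s m e"
        using subgroup.one_closed[OF submodule.axioms(1)[OF jj_kernel_submodule[of s m e]]] by simp
      ultimately show ?thesis by (simp only: class_zero)
    qed
    assume "f \<in> ?N"
    then show "jj_class s m e f = \<zero>\<^bsub>jj_module s m e\<^esub>"
    proof (induction rule: jj_null.induct)
      case (null_add f g)
      then show ?case by (simp add: \<pi>.map_add)
    next
      case (null_scale f c)
      then show ?case by (simp add: \<pi>.map_scale)
    next
      case (cube a)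
      show ?case using cube_in_jj_kernel[of s m a e] by (simp only: class_zero q.map_diff tensor_q)
    qed (rule tensor, unfold tensor_relations_def, blast)+
  }
qed

section \<open>Multiplication and inner derivations attached to \<open>\<langle>J, J\<rangle>\<close>\<close>

text \<open>
  The torsion condition is phrased in the free module: \<open>f + f\<close> is zero in \<open>\<langle>J, J\<rangle>\<close> only if \<open>f\<close> is.
\<close>

locale jordan_jj_no_two_torsion = unital_jordan_algebra scale jmult unit
  for scale :: "'k::comm_ring_1 \<Rightarrow> 'j::ab_group_add \<Rightarrow> 'j"
    and jmult (infixl \<open>\<bullet>\<close> 70) and unit +
  assumes null_two_torsion:
    "f + f \<in> jj_null scale jmult unit \<Longrightarrow> f \<in> jj_null scale jmult unit"
begin

abbreviation K where "K \<equiv> jj_null scale jmult unit"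

abbreviation br :: "'j \<Rightarrow> 'j \<Rightarrow> ('j \<times> 'j \<Rightarrow>\<^sub>0 'k)" where "br a b \<equiv> pure a b"

lemma null_minus: "f \<in> K \<Longrightarrow> - f \<in> K"
  using null_scale[of f _ _ _ "- 1"] by simp

lemma null_diff: "f \<in> K \<Longrightarrow> g \<in> K \<Longrightarrow> f - g \<in> K"
  using null_add[OF _ null_minus, of f g] by simp

lemma null_zero [simp]: "0 \<in> K"
  using null_diff[OF cube cube, of undefined undefined] by simp

lemma br_zero_left: "br 0 b \<in> K"
  using null_minus[OF pure_add_left[of 0 0 b]] by simp

lemma br_zero_right: "br a 0 \<in> K"
  using null_minus[OF pure_add_right[of a 0 0]] by simp

lemma br_minus_right: "br a (- b) + br a b \<in> K"
  using null_diff[OF br_zero_right[of a] pure_add_right[of a b "- b"]] by (simp add: add.commute)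

lemma br_diff_left: "br (a - a') b - br a b + br a' b \<in> K"
  using null_minus[OF pure_add_left[of "a - a'" a' b]] by (simp add: algebra_simps)

lemma br_diff_right: "br a (b - b') - br a b + br a b' \<in> K"
  using null_minus[OF pure_add_right[of a "b - b'" b']] by (simp add: algebra_simps)

definition mul :: "('j \<times> 'j \<Rightarrow>\<^sub>0 'k) \<Rightarrow> 'j" where
  "mul = linear_extension scale (\<lambda>(a, b). a \<bullet> b)"

lemma mul_pure [simp]: "mul (br a b) = a \<bullet> b"
  and mul_add: "mul (U + V) = mul U + mul V"
  and mul_scale: "mul (free_scale c U) = scale c (mul U)"
  by (simp_all add: mul_def linear_extension_add linear_extension_scale)

lemma mul_minus: "mul (- U) = - mul U"
  using mul_scale[of "- 1" U] by simp

lemma mul_diff: "mul (U - V) = mul U - mul V"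
  using mul_add[of U "- V"] by (simp add: mul_minus)

text \<open>
  The cubic relation survives multiplication because both of its sides have product \<open>a\<^sup>3\<close>.
\<close>

lemma mul_null: "U \<in> K \<Longrightarrow> mul U = 0"
  by (induction rule: jj_null.induct)
    (simp_all add: mul_add mul_scale mul_diff jmult_linear jmult_scale_left jmult_scale_right unit_left)

text \<open>
  Multiplication sends \<open>\<langle>1, x\<rangle>\<close> to \<open>x\<close>, so \<open>J\<close> embeds into \<open>\<langle>J, J\<rangle>\<close>.
\<close>

lemma embedded_no_two_torsion:
  fixes x :: 'j
  assumes "x + x = 0" shows "x = 0"
proof -
  have "br unit x + br unit x = br unit 0 - (br unit (x + x) - br unit x - br unit x)"
    by (simp add: assms)
  also have "\<dots> \<in> K" by (intro null_diff br_zero_right pure_add_right)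
  finally have "br unit x \<in> K" by (rule null_two_torsion)
  from mul_null[OF this] show ?thesis by (simp add: unit_left)
qed

sublocale jordan_algebra_no_two_torsion scale jmult
  by unfold_locales (rule embedded_no_two_torsion)

lemma inner_unit [simp]: "inner unit a c = 0" "inner a unit c = 0"
  by (simp_all add: inner_def unit_left)

definition der :: "('j \<times> 'j \<Rightarrow>\<^sub>0 'k) \<Rightarrow> 'j \<Rightarrow> 'j" where
  "der U c = linear_extension scale (\<lambda>(a, b). inner a b c) U"

lemma der_pure [simp]: "der (br a b) c = inner a b c"
  and der_add: "der (U + V) c = der U c + der V c"
  and der_scale: "der (free_scale r U) c = scale r (der U c)"
  by (simp_all add: der_def linear_extension_add linear_extension_scale)

lemma der_diff: "der (U - V) c = der U c - der V c"
  using der_add[of U "- V"] der_scale[of "- 1" V] by simp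

lemma der_add_right: "der U (c + d) = der U c + der U d"
  by (induction U rule: free_module_induct)
    (simp_all add: der_add der_scale inner_linear scale_right_distrib)

lemma der_scale_right: "der U (scale r c) = scale r (der U c)"
  by (induction U rule: free_module_induct)
    (simp_all add: der_add der_scale inner_scale scale_right_distrib mult.commute)

lemma der_minus_right: "der U (- c) = - der U c"
  using der_scale_right[of U "- 1" c] by simp

lemma der_diff_right: "der U (c - d) = der U c - der U d"
  using der_add_right[of U c "- d"] by (simp add: der_minus_right)

lemma der_derivation: "der U (c \<bullet> d) = der U c \<bullet> d + c \<bullet> der U d"
  by (induction U rule: free_module_induct)
    (simp_all add: der_add der_scale inner_derivation jmult_linear jmult_scale_left jmult_scale_right
      scale_right_distrib)

lemma der_unit [simp]: "der U unit = 0"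
  using der_derivation[of U unit unit] by (simp add: unit_left unit_right)

text \<open>
  On the cubic relation this is the Jordan identity in the form \<open>[L\<^sub>a\<^sub>a, L\<^sub>a] = 0\<close>.
\<close>

lemma der_null: "U \<in> K \<Longrightarrow> der U c = 0"
  by (induction rule: jj_null.induct)
    (simp_all add: der_add der_scale der_diff inner_linear inner_scale inner_square)

lemma der_tr: "der U (tr c d e) = tr (der U c) d e + tr c (der U d) e + tr c d (der U e)"
  by (simp add: triple_def der_add_right der_diff_right der_derivation jmult_linear)

section \<open>The actions on \<open>J\<^sub>-\<close> and \<open>J\<^sub>+\<close> and the bracket on \<open>\<langle>J, J\<rangle>\<close>\<close>

text \<open>
  The actions on \<open>J\<^sub>-\<close> and on \<open>J\<^sub>+\<close>. Defining them through \<open>der\<close> and \<open>mul\<close>, rather than as linear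
  extensions of the triple product, lets the identities below be proved for all elements at once.
\<close>

definition act_neg :: "('j \<times> 'j \<Rightarrow>\<^sub>0 'k) \<Rightarrow> 'j \<Rightarrow> 'j" where
  "act_neg U c = der U c + mul U \<bullet> c"

definition act_pos :: "('j \<times> 'j \<Rightarrow>\<^sub>0 'k) \<Rightarrow> 'j \<Rightarrow> 'j" where
  "act_pos U d = der U d - mul U \<bullet> d"

lemmas act_defs = act_neg_def act_pos_def

lemma act_neg_pure [simp]: "act_neg (br a b) c = tr a b c"
  by (simp add: act_neg_def tr_eq)

lemma act_pos_pure [simp]: "act_pos (br a b) d = - tr b a d"
  by (simp add: act_pos_def tr_eq inner_swap[of b a] jmult_commute)

lemma act_add: "act_neg (U + V) c = act_neg U c + act_neg V c"
    "act_pos (U + V) c = act_pos U c + act_pos V c"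
  and act_scale: "act_neg (free_scale r U) c = scale r (act_neg U c)"
    "act_pos (free_scale r U) c = scale r (act_pos U c)"
  and act_null: "U \<in> K \<Longrightarrow> act_neg U c = 0" "U \<in> K \<Longrightarrow> act_pos U c = 0"
  and act_add_right: "act_neg U (c + d) = act_neg U c + act_neg U d"
    "act_pos U (c + d) = act_pos U c + act_pos U d"
  and act_diff_right: "act_neg U (c - d) = act_neg U c - act_neg U d"
    "act_pos U (c - d) = act_pos U c - act_pos U d"
  and act_minus_right: "act_neg U (- d) = - act_neg U d"
    "act_pos U (- d) = - act_pos U d"
  and act_scale_right: "act_neg U (scale r c) = scale r (act_neg U c)"
    "act_pos U (scale r c) = scale r (act_pos U c)"
  by (simp_all add: act_defs der_add mul_add der_scale mul_scale der_null mul_null der_add_right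
      der_diff_right der_scale_right der_minus_right jmult_linear jmult_scale_left jmult_scale_right
      scale_right_distrib scale_right_diff_distrib)

text \<open>
  The derivation identity of the Jordan pair \<open>(J\<^sub>-, J\<^sub>+)\<close>: \<open>der U\<close> contributes by \<open>der_tr\<close> and
  \<open>mul U\<close> by \<open>tr_mult\<close>, whose minus sign is the sign of \<open>mul U\<close> in \<open>act_pos\<close>.
\<close>

lemma act_tr:
  "act_neg U (tr c d e) = tr (act_neg U c) d e + tr c (act_pos U d) e + tr c d (act_neg U e)"
  "act_pos U (tr d c e) = tr (act_pos U d) c e + tr d (act_neg U c) e + tr d c (act_pos U e)"
  by (simp_all add: act_defs der_tr tr_mult tr_linear)

text \<open>
  The bracket at the level of the free module. It is linear in \<open>V\<close> on the nose, but in \<open>U\<close> only modulo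
  the relations, because \<open>U\<close> enters through the values of its actions.
\<close>

definition com :: "('j \<times> 'j \<Rightarrow>\<^sub>0 'k) \<Rightarrow> ('j \<times> 'j \<Rightarrow>\<^sub>0 'k) \<Rightarrow> ('j \<times> 'j \<Rightarrow>\<^sub>0 'k)" where
  "com U V = linear_extension free_scale (\<lambda>(c, d). br (act_neg U c) d + br c (act_pos U d)) V"

lemma com_pure [simp]: "com U (br c d) = br (act_neg U c) d + br c (act_pos U d)"
  and com_add_right: "com U (V + W) = com U V + com U W"
  and com_scale_right: "com U (free_scale r V) = free_scale r (com U V)"
  by (simp_all add: com_def free.linear_extension_add free.linear_extension_scale)

lemma com_minus_right: "com U (- V) = - com U V"
  using com_scale_right[of U "- 1" V] by simp

lemma com_diff_right: "com U (V - W) = com U V - com U W"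
  using com_add_right[of U V "- W"] by (simp add: com_minus_right)

lemma act_com:
  "act_neg (com U V) e = act_neg U (act_neg V e) - act_neg V (act_neg U e)"
  "act_pos (com U V) e = act_pos U (act_pos V e) - act_pos V (act_pos U e)"
proof (induction V rule: free_module_induct)
  case (pure c d)
  { case 1 show ?case by (simp add: act_add act_tr) next
    case 2 show ?case by (simp add: act_add act_minus_right act_tr) }
next
  case (add V W)
  { case 1 show ?case using add by (simp add: com_add_right act_add act_add_right) next
    case 2 show ?case using add by (simp add: com_add_right act_add act_add_right) }
next
  case (scale r V)
  { case 1 show ?case using scale 
     by (simp add: com_scale_right act_scale act_scale_right scale_right_diff_distrib) next
    case 2 show ?case using scale
     by (simp add: com_scale_right act_scale act_scale_right scale_right_diff_distrib) }
qed

section \<open>Skew-symmetric generators of \<open>\<langle>J, J\<rangle>\<close>\<close>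

text \<open>
  Modulo \<open>\<langle>1, J\<rangle>\<close> the generator \<open>\<langle>a, b\<rangle>\<close> becomes skew-symmetric; subtracting \<open>\<langle>1, ab\<rangle>\<close> makes this an identity
  in \<open>\<langle>J, J\<rangle>\<close> itself (\<open>skew_swap\<close>).
\<close>

definition skew :: "'j \<Rightarrow> 'j \<Rightarrow> ('j \<times> 'j \<Rightarrow>\<^sub>0 'k)" where
  "skew a b = br a b - br unit (a \<bullet> b)"

lemma skew_add:
  "skew (a + a') b - skew a b - skew a' b \<in> K" "skew a (b + b') - skew a b - skew a b' \<in> K"
proof -
  have "skew (a + a') b - skew a b - skew a' b = (br (a + a') b - br a b - br a' b)
    - (br unit (a \<bullet> b + a' \<bullet> b) - br unit (a \<bullet> b) - br unit (a' \<bullet> b))"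
    by (simp add: skew_def jmult_linear)
  also have "\<dots> \<in> K" by (intro null_diff pure_add_left pure_add_right)
  finally show "skew (a + a') b - skew a b - skew a' b \<in> K" .
  have "skew a (b + b') - skew a b - skew a b' = (br a (b + b') - br a b - br a b')
    - (br unit (a \<bullet> b + a \<bullet> b') - br unit (a \<bullet> b) - br unit (a \<bullet> b'))"
    by (simp add: skew_def jmult_linear)
  also have "\<dots> \<in> K" by (intro null_diff pure_add_left pure_add_right)
  finally show "skew a (b + b') - skew a b - skew a b' \<in> K" .
qed

text \<open>
  The polarized form of the relation \<open>\<langle>a\<^sup>2, a\<rangle> = \<langle>1, a\<^sup>3\<rangle>\<close>, which says \<open>skew (a\<^sup>2) a = 0\<close>.
\<close>

lemma skew_cyclic: "skew (a \<bullet> b) c + skew (b \<bullet> c) a + skew (c \<bullet> a) b \<in> K"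
proof -
  define t where "t a b c = skew (a \<bullet> b) c" for a b c
  have sym: "t x y w = t y x w" for x y w by (simp add: t_def jmult_commute)
  have "t a b c + t a c b + t b a c + t b c a + t c a b + t c b a \<in> K"
    by (rule cubic_polarization)
      (simp_all add: null_add null_diff t_def jmult_linear skew_add, simp add: skew_def cube)
  then have "(t a b c + t b c a + t c a b) + (t a b c + t b c a + t c a b) \<in> K"
    by (simp add: sym add.assoc add.commute add.left_commute)
  then show ?thesis unfolding t_def by (rule null_two_torsion)
qed

text \<open>
  Setting two arguments of \<open>skew_cyclic\<close> to \<open>1\<close> shows \<open>2 skew x 1 = 0\<close>, hence \<open>skew x 1 = 0\<close>; setting
  one of them to \<open>1\<close> then leaves the claim.
\<close>

lemma skew_swap: "skew a b + skew b a \<in> K"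
proof -
  have "skew unit unit = 0" "skew unit x = 0" for x by (simp_all add: skew_def unit_left)
  then have "skew x unit + skew x unit \<in> K" for x
    using skew_cyclic[of x unit unit] by (simp add: unit_left unit_right)
  then have "skew (a \<bullet> b) unit \<in> K" by (rule null_two_torsion)
  from null_diff[OF skew_cyclic[of a b unit] this] show ?thesis
    by (simp add: unit_left unit_right add.commute)
qed

lemma skew_unit [simp]: "skew unit a = 0"
  by (simp add: skew_def unit_left)

text \<open>
  The shape of \<open>skew_cyclic\<close> in which \<open>x\<close> moves from the first argument to the second. It matches the
  sign of \<open>L\<^sub>x\<close> in the action on \<open>J\<^sub>+\<close>.
\<close>

lemma skew_shift: "skew (x \<bullet> y) z - skew y (x \<bullet> z) + skew (y \<bullet> z) x \<in> K"
proof -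
  have "skew (x \<bullet> y) z - skew y (x \<bullet> z) + skew (y \<bullet> z) x =
    (skew (x \<bullet> y) z + skew (y \<bullet> z) x + skew (z \<bullet> x) y) - (skew y (x \<bullet> z) + skew (x \<bullet> z) y)"
    by (simp add: jmult_commute)
  also have "\<dots> \<in> K" by (intro null_diff skew_cyclic skew_swap)
  finally show ?thesis .
qed

lemma skew_diff:
  "skew (a - a') b - skew a b + skew a' b \<in> K" "skew a (b - b') - skew a b + skew a b' \<in> K"
proof -
  have "skew (a - a') b - skew a b + skew a' b = - (skew (a - a' + a') b - skew (a - a') b - skew a' b)"
    "skew a (b - b') - skew a b + skew a b' = - (skew a (b - b' + b') - skew a (b - b') - skew a b')"
    by simp_all
  then show "skew (a - a') b - skew a b + skew a' b \<in> K" "skew a (b - b') - skew a b + skew a b' \<in> K"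
    by (simp_all only: null_minus skew_add)
qed

lemma skew_tr:
  "skew (tr a b c) d - (skew ((a \<bullet> b) \<bullet> c) d + skew (a \<bullet> (b \<bullet> c)) d - skew (b \<bullet> (c \<bullet> a)) d) \<in> K"
  "skew d (tr a b c) - (skew d ((a \<bullet> b) \<bullet> c) + skew d (a \<bullet> (b \<bullet> c)) - skew d (b \<bullet> (c \<bullet> a))) \<in> K"
proof -
  have *: "skew (u + v - w) d - (skew u d + skew v d - skew w d) =
      (skew (u + v - w) d - skew (u + v) d + skew w d) + (skew (u + v) d - skew u d - skew v d)"
    "skew d (u + v - w) - (skew d u + skew d v - skew d w) =
      (skew d (u + v - w) - skew d (u + v) + skew d w) + (skew d (u + v) - skew d u - skew d v)" for u v w
    by simp_all
  show "skew (tr a b c) d - (skew ((a \<bullet> b) \<bullet> c) d + skew (a \<bullet> (b \<bullet> c)) d - skew (b \<bullet> (c \<bullet> a)) d) \<in> K"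
    "skew d (tr a b c) - (skew d ((a \<bullet> b) \<bullet> c) + skew d (a \<bullet> (b \<bullet> c)) - skew d (b \<bullet> (c \<bullet> a))) \<in> K"
    unfolding triple_def * by (rule null_add[OF skew_diff(1) skew_add(1)], rule null_add[OF skew_diff(2) skew_add(2)])
qed

lemma br_unit_balanced:
  assumes "w + x = y + z"
  shows "br unit w + br unit x - br unit y - br unit z \<in> K"
proof -
  have "br unit w + br unit x - br unit y - br unit z =
    (br unit (y + z) - br unit y - br unit z) - (br unit (w + x) - br unit w - br unit x)"
    by (simp add: assms)
  also have "\<dots> \<in> K" by (intro null_diff pure_add_right)
  finally show ?thesis .
qed

section \<open>Well-definedness, skew-symmetry and the Jacobi identity for the bracket on \<open>\<langle>J, J\<rangle>\<close>\<close>

text \<open>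
  The bracket with \<open>U\<close> respects the cubic relation. The derivation \<open>D = der U\<close> respects it because
  the relation can be polarized at \<open>(a, a, Da)\<close>; for \<open>L\<^sub>x\<close> with \<open>x = mul U\<close> it amounts to
  \<open>skew (xa\<^sup>2) a - skew (a\<^sup>2) (xa) = skew x (a\<^sup>3)\<close>, an instance of \<open>skew_shift\<close> up to a swap. What
  remains has the form \<open>\<langle>1, y\<rangle>\<close> where \<open>y = 0\<close> by the Jordan identity.
\<close>

lemma com_cube: "com U (br (a \<bullet> a) a - br unit ((a \<bullet> a) \<bullet> a)) \<in> K"
proof -
  define x where "x = mul U"
  define D where "D = der U a"
  define c where "c = (a \<bullet> a) \<bullet> a"
  have D: "der U (a \<bullet> a) = a \<bullet> D + a \<bullet> D" "der U c = (a \<bullet> D + a \<bullet> D) \<bullet> a + (a \<bullet> a) \<bullet> D"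
    by (simp_all add: c_def D_def der_derivation jmult_commute)
  let ?P = "(a \<bullet> D + a \<bullet> D) + x \<bullet> (a \<bullet> a)" and ?Q = "D - x \<bullet> a" and ?R = "der U c - x \<bullet> c"
  \<comment> \<open>The products of the four generators \<open>\<langle>u, v\<rangle>\<close> that occur in the bracket cancel.\<close>
  have balanced: "?P \<bullet> a + (a \<bullet> a) \<bullet> ?Q = x \<bullet> c + ?R"
    using jordan_identity[of a x] by (simp add: D jmult_linear jmult_commute)
  have "com U (br (a \<bullet> a) a - br unit c) = br ?P a + br (a \<bullet> a) ?Q - br x c - br unit ?R"
    by (simp add: com_diff_right act_defs D D_def[symmetric] x_def[symmetric] unit_right)
  also have "\<dots> = (br unit (?P \<bullet> a) + br unit ((a \<bullet> a) \<bullet> ?Q) - br unit (x \<bullet> c) - br unit ?R)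
    + (skew ?P a - skew (a \<bullet> D + a \<bullet> D) a - skew (x \<bullet> (a \<bullet> a)) a)
    + (skew (a \<bullet> D + a \<bullet> D) a - skew (a \<bullet> D) a - skew (a \<bullet> D) a)
    + (skew (a \<bullet> a) ?Q - skew (a \<bullet> a) D + skew (a \<bullet> a) (x \<bullet> a))
    + (skew (a \<bullet> a) D + skew (a \<bullet> D) a + skew (D \<bullet> a) a)
    + (skew (x \<bullet> (a \<bullet> a)) a - skew (a \<bullet> a) (x \<bullet> a) + skew c x) - (skew x c + skew c x)"
    by (simp add: skew_def jmult_commute)
  also have "\<dots> \<in> K"
    by (rule br_unit_balanced[OF balanced] skew_add skew_diff skew_cyclic skew_swap
        skew_shift[of x "a \<bullet> a" a, folded c_def] | rule null_add null_diff)+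
  finally show ?thesis by (simp add: c_def)
qed

lemma com_null_right: "V \<in> K \<Longrightarrow> com U V \<in> K"
proof (induction rule: jj_null.induct)
  case (pure_add_left a a' b)
  have "com U (br (a + a') b - br a b - br a' b) =
    (br (act_neg U a + act_neg U a') b - br (act_neg U a) b - br (act_neg U a') b)
    + (br (a + a') (act_pos U b) - br a (act_pos U b) - br a' (act_pos U b))"
    by (simp add: com_diff_right act_add_right)
  also have "\<dots> \<in> K" by (intro null_add jj_null.pure_add_left)
  finally show ?case .
next
  case (pure_add_right a b b')
  have "com U (br a (b + b') - br a b - br a b') =
    (br (act_neg U a) (b + b') - br (act_neg U a) b - br (act_neg U a) b')
    + (br a (act_pos U b + act_pos U b') - br a (act_pos U b) - br a (act_pos U b'))"
    by (simp add: com_diff_right act_add_right)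
  also have "\<dots> \<in> K" by (intro null_add jj_null.pure_add_right)
  finally show ?case .
next
  case (pure_scale_left r a b)
  have "com U (br (scale r a) b - free_scale r (br a b)) =
    (br (scale r (act_neg U a)) b - free_scale r (br (act_neg U a) b))
    + (br (scale r a) (act_pos U b) - free_scale r (br a (act_pos U b)))"
    by (simp add: com_diff_right com_scale_right act_scale_right free.scale_right_distrib)
  also have "\<dots> \<in> K" by (intro null_add jj_null.pure_scale_left)
  finally show ?case .
next
  case (pure_scale_right a r b)
  have "com U (br a (scale r b) - free_scale r (br a b)) =
    (br (act_neg U a) (scale r b) - free_scale r (br (act_neg U a) b))
    + (br a (scale r (act_pos U b)) - free_scale r (br a (act_pos U b)))"
    by (simp add: com_diff_right com_scale_right act_scale_right free.scale_right_distrib)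
  also have "\<dots> \<in> K" by (intro null_add jj_null.pure_scale_right)
  finally show ?case .
qed (simp_all add: com_add_right com_scale_right com_cube null_add null_scale)

lemma com_add_left: "com (U + V) W - com U W - com V W \<in> K"
proof (induction W rule: free_module_induct)
  case (pure c d)
  have "com (U + V) (br c d) - com U (br c d) - com V (br c d) =
    (br (act_neg U c + act_neg V c) d - br (act_neg U c) d - br (act_neg V c) d)
    + (br c (act_pos U d + act_pos V d) - br c (act_pos U d) - br c (act_pos V d))"
    by (simp add: act_add)
  also have "\<dots> \<in> K" by (intro null_add pure_add_left pure_add_right)
  finally show ?case .
next
  case (add W W')
  from null_add[OF this] show ?case by (simp add: com_add_right add_diff_add)
next
  case (scale r W)
  from null_scale[OF this, of r] show ?case by (simp add: com_scale_right free.scale_right_diff_distrib)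
qed

lemma com_scale_left: "com (free_scale r U) W - free_scale r (com U W) \<in> K"
proof (induction W rule: free_module_induct)
  case (pure c d)
  have "com (free_scale r U) (br c d) - free_scale r (com U (br c d)) =
    (br (scale r (act_neg U c)) d - free_scale r (br (act_neg U c) d))
    + (br c (scale r (act_pos U d)) - free_scale r (br c (act_pos U d)))"
    by (simp add: act_scale free.scale_right_distrib)
  also have "\<dots> \<in> K" by (intro null_add pure_scale_left pure_scale_right)
  finally show ?case .
next
  case (add W W')
  from null_add[OF this] show ?case
    by (simp add: com_add_right free.scale_right_distrib add_diff_add)
next
  case (scale t W)
  from null_scale[OF this, of t] show ?case
    by (simp add: com_scale_right free.scale_right_diff_distrib mult.commute)
qed

text \<open>
  An element of \<open>jj_null\<close> acts as zero on \<open>J\<^sub>-\<close> and \<open>J\<^sub>+\<close>.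
\<close>

lemma com_null_left: "U \<in> K \<Longrightarrow> com U V \<in> K"
  by (induction V rule: free_module_induct)
    (simp_all add: com_add_right com_scale_right act_null null_add null_scale br_zero_left br_zero_right)

text \<open>
  Rewriting each \<open>\<langle>u, v\<rangle>\<close> as \<open>skew u v + \<langle>1, uv\<rangle>\<close> splits the claim. The parts \<open>\<langle>1, uv\<rangle>\<close> cancel
  because \<open>[L\<^sub>a, L\<^sub>b](cd) + [L\<^sub>c, L\<^sub>d](ab)\<close> can be expanded by definition and by the derivation rule.
  For the others, expand the triple products, so that twelve terms \<open>skew u v\<close> appear. They form six
  pairs to each of which \<open>skew_cyclic\<close> or \<open>skew_shift\<close> applies, up to a swap, leaving \<open>skew\<close> of two
  products of two variables; these six cancel by \<open>skew_swap\<close>.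
\<close>

lemma com_pure_skew: "com (br a b) (br c d) + com (br c d) (br a b) \<in> K"
proof -
  let ?S = "skew (tr a b c) d - skew c (tr b a d) + skew (tr c d a) b - skew a (tr d c b)"
  have "?S = (skew (tr a b c) d - (skew ((a \<bullet> b) \<bullet> c) d + skew (a \<bullet> (b \<bullet> c)) d - skew (b \<bullet> (c \<bullet> a)) d))
    - (skew c (tr b a d) - (skew c ((b \<bullet> a) \<bullet> d) + skew c (b \<bullet> (a \<bullet> d)) - skew c (a \<bullet> (d \<bullet> b))))
    + (skew (tr c d a) b - (skew ((c \<bullet> d) \<bullet> a) b + skew (c \<bullet> (d \<bullet> a)) b - skew (d \<bullet> (a \<bullet> c)) b))
    - (skew a (tr d c b) - (skew a ((d \<bullet> c) \<bullet> b) + skew a (d \<bullet> (c \<bullet> b)) - skew a (c \<bullet> (b \<bullet> d))))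
    + (skew ((a \<bullet> b) \<bullet> c) d - skew c ((a \<bullet> b) \<bullet> d) + skew (c \<bullet> d) (a \<bullet> b))
    + (skew ((c \<bullet> d) \<bullet> a) b - skew a ((c \<bullet> d) \<bullet> b) + skew (a \<bullet> b) (c \<bullet> d))
    - (skew (c \<bullet> d) (a \<bullet> b) + skew (a \<bullet> b) (c \<bullet> d))
    + (skew ((b \<bullet> c) \<bullet> a) d - skew a ((b \<bullet> c) \<bullet> d) + skew (a \<bullet> d) (b \<bullet> c))
    + (skew ((a \<bullet> d) \<bullet> c) b - skew c ((a \<bullet> d) \<bullet> b) + skew (c \<bullet> b) (a \<bullet> d))
    - (skew (a \<bullet> d) (b \<bullet> c) + skew (b \<bullet> c) (a \<bullet> d))
    - (skew ((a \<bullet> c) \<bullet> b) d + skew (b \<bullet> d) (a \<bullet> c) + skew (d \<bullet> (a \<bullet> c)) b)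
    - (skew ((b \<bullet> d) \<bullet> a) c + skew (a \<bullet> c) (b \<bullet> d) + skew (c \<bullet> (b \<bullet> d)) a)
    + (skew (a \<bullet> c) (b \<bullet> d) + skew (b \<bullet> d) (a \<bullet> c))
    + (skew ((b \<bullet> d) \<bullet> a) c + skew c ((b \<bullet> d) \<bullet> a)) + (skew ((b \<bullet> d) \<bullet> c) a + skew a ((b \<bullet> d) \<bullet> c))"
    by (simp add: jmult_commute)
  also have "\<dots> \<in> K"
    by (rule skew_tr skew_swap skew_cyclic skew_shift | rule null_add null_diff)+
  finally have S: "?S \<in> K" .
  have "com (br a b) (br c d) + com (br c d) (br a b) = ?S
    + (br unit (tr a b c \<bullet> d) + br unit (tr c d a \<bullet> b) - br unit (c \<bullet> tr b a d) - br unit (a \<bullet> tr d c b))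
    + (br c (- tr b a d) + br c (tr b a d)) + (br a (- tr d c b) + br a (tr d c b))"
    by (simp add: skew_def)
  also have "\<dots> \<in> K"
  proof (rule null_add[OF null_add[OF null_add[OF S br_unit_balanced] br_minus_right] br_minus_right])
    have "inner a b (c \<bullet> d) + inner c d (a \<bullet> b) = (c \<bullet> ((a \<bullet> b) \<bullet> d) - d \<bullet> ((a \<bullet> b) \<bullet> c))
        + (a \<bullet> ((c \<bullet> d) \<bullet> b) - b \<bullet> ((c \<bullet> d) \<bullet> a))"
      by (simp add: inner_def jmult_commute)
    then show "tr a b c \<bullet> d + tr c d a \<bullet> b = c \<bullet> tr b a d + a \<bullet> tr d c b"
      unfolding inner_derivation tr_eq inner_swap[of b a] inner_swap[of d c]
      by (simp add: jmult_linear jmult_commute algebra_simps)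
  qed
  finally show ?thesis .
qed

text \<open>
  Bilinearity modulo the relations reduces this to \<open>com_pure_skew\<close>. The induction on \<open>V\<close> comes first,
  with \<open>U\<close> a generator, and its result is the base case of the induction on \<open>U\<close>.
\<close>

lemma com_skew: "com U V + com V U \<in> K"
proof -
  have add_skew: "com W (V + V') + com (V + V') W \<in> K"
    if "com W V + com V W \<in> K" "com W V' + com V' W \<in> K" for W V V'
    using null_add[OF null_add[OF that] com_add_left[of V V' W]] by (simp add: com_add_right)
  have scale_skew: "com W (free_scale r V) + com (free_scale r V) W \<in> K"
    if "com W V + com V W \<in> K" for W V r
    using null_add[OF null_scale[OF that, of r] com_scale_left[of r V W]]
    by (simp add: com_scale_right free.scale_right_distrib)
  have *: "com (br a b) V + com V (br a b) \<in> K" for a b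
    by (induction V rule: free_module_induct) (simp_all only: com_pure_skew add_skew scale_skew)
  show ?thesis
  proof (induction U rule: free_module_induct)
    case (pure a b) show ?case by (rule *)
  next
    case (add U U') then show ?case using add_skew[of V U U'] by (simp add: add.commute)
  next
    case (scale r U) then show ?case using scale_skew[of V U r] by (simp add: add.commute)
  qed
qed

text \<open>
  On a generator \<open>\<langle>c, d\<rangle>\<close> the mixed terms, in which \<open>U\<close> acts on one entry and \<open>V\<close> on the other, cancel,
  and the rest is \<open>act_com\<close> in each entry.
\<close>

lemma com_derivation: "com U (com V W) - com V (com U W) - com (com U V) W \<in> K"
proof (induction W rule: free_module_induct)
  case (pure c d)
  let ?n = "\<lambda>U. act_neg U" and ?p = "\<lambda>U. act_pos U"
  have "com U (com V (br c d)) - com V (com U (br c d)) - com (com U V) (br c d) =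
    - (br (?n U (?n V c) - ?n V (?n U c)) d - br (?n U (?n V c)) d + br (?n V (?n U c)) d)
    - (br c (?p U (?p V d) - ?p V (?p U d)) - br c (?p U (?p V d)) + br c (?p V (?p U d)))"
    by (simp add: com_add_right act_com)
  also have "\<dots> \<in> K" by (intro null_diff null_minus br_diff_left br_diff_right)
  finally show ?case .
next
  case (add W W')
  from null_add[OF this] show ?case by (simp add: com_add_right add_diff_add)
next
  case (scale r W)
  from null_scale[OF this, of r] show ?case
    by (simp add: com_scale_right free.scale_right_diff_distrib)
qed

lemma com_alternating: "com U U \<in> K"
  using com_skew by (rule null_two_torsion)

lemma com_jacobi: "com U (com V W) + com V (com W U) + com W (com U V) \<in> K"
proof -
  have "com U (com V W) + com V (com W U) + com W (com U V) =
    (com U (com V W) - com V (com U W) - com (com U V) W)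
    + com V (com U W + com W U) + (com W (com U V) + com (com U V) W)"
    by (simp add: com_add_right)
  also have "\<dots> \<in> K"
    by (intro null_add com_derivation com_null_right com_skew)
  finally show ?thesis .
qed

end

section \<open>Existence of the products\<close>

context jordan_jj_no_two_torsion
begin

abbreviation Q where "Q \<equiv> jj_module scale jmult unit"
abbreviation cls where "cls \<equiv> jj_class scale jmult unit"

sublocale cls: linear_surjection Q cls
  by (rule linear_surjection_jj_class)

lemma cls_eq_iff: "cls f = cls g \<longleftrightarrow> f - g \<in> K"
  unfolding cls.map_eq_iff[of f g] by (rule jj_class_eq_zero_iff)

lemma cls_eqI: "f - g \<in> K \<Longrightarrow> cls f = cls g"
  by (simp only: cls_eq_iff)

lemma cls_null: "f \<in> K \<Longrightarrow> cls f = \<zero>\<^bsub>Q\<^esub>"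
  by (simp only: jj_class_eq_zero_iff)

lemma act_cong: "f - g \<in> K \<Longrightarrow> act_neg f c = act_neg g c" "f - g \<in> K \<Longrightarrow> act_pos f c = act_pos g c"
  using act_add[of "f - g" g c] by (simp_all add: act_null)

lemma com_cong: "f - f' \<in> K \<Longrightarrow> g - g' \<in> K \<Longrightarrow> com f g - com f' g' \<in> K"
proof -
  assume f: "f - f' \<in> K" and g: "g - g' \<in> K"
  have "com f g - com f' g' = com f (g - g') + (com (f - f' + f') g' - com (f - f') g' - com f' g')
    + com (f - f') g'"
    by (simp add: com_diff_right)
  also have "\<dots> \<in> K" by (intro null_add com_add_left com_null_left com_null_right f g)
  finally show ?thesis .
qed

lemma cls_com_add_left: "cls (com (f + f') g) = cls (com f g + com f' g)"
  by (rule cls_eqI) (use com_add_left[of f f' g] in \<open>simp add: diff_diff_add\<close>)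

lemma cls_com_scale_left: "cls (com (free_scale r f) g) = cls (free_scale r (com f g))"
  by (rule cls_eqI) (rule com_scale_left)

text \<open>
  Each product is computed on representatives in the free module; \<open>act_cong\<close> and \<open>com_cong\<close> make the
  result independent of the choice.
\<close>

lemma tkk_products_exist: "\<exists>act_minus act_plus comQ. tkk_products scale jmult unit act_minus act_plus comQ"
proof -
  define rep where "rep U = (SOME f. cls f = U)" for U
  have "cls (rep (cls f)) = cls f" for f
    unfolding rep_def by (rule someI) (rule refl)
  then have rep: "rep (cls f) - f \<in> K" for f by (simp only: cls_eq_iff)
  have act_minus: "act_neg (rep (cls f)) c = act_neg f c" and act_plus: "act_pos (rep (cls f)) c = act_pos f c" for f c
    by (rule act_cong[OF rep])+
  define C where "C U V = cls (com (rep U) (rep V))" for U V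
  have comQ: "C (cls f) (cls g) = cls (com f g)" for f g
    unfolding C_def by (rule cls_eqI, rule com_cong[OF rep rep])
  have cls_pure: "jj scale jmult unit a b = cls (br a b)" for a b by (simp only: jj_class_pure)
  have "tkk_products scale jmult unit (\<lambda>U. act_neg (rep U)) (\<lambda>U. act_pos (rep U)) C"
    unfolding tkk_products_def Let_def
  proof (intro conjI allI)
    show "bilinear_on Q (module_of scale) (module_of scale) (\<lambda>U. act_neg (rep U))"
      unfolding bilinear_on_def cls.carrier_eq
      by (auto simp: module_of_def act_minus act_add act_scale act_add_right act_scale_right
          simp flip: cls.map_add cls.map_scale)
    show "bilinear_on Q (module_of scale) (module_of scale) (\<lambda>U. act_pos (rep U))"
      unfolding bilinear_on_def cls.carrier_eq
      by (auto simp: module_of_def act_plus act_add act_scale act_add_right act_scale_right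
          simp flip: cls.map_add cls.map_scale)
    show "bilinear_on Q Q Q C"
      unfolding bilinear_on_def cls.carrier_eq
      by (auto simp: comQ com_add_right com_scale_right cls_com_add_left cls_com_scale_left simp flip: cls.map_add cls.map_scale)
    fix a b c d
    show "act_neg (rep (jj scale jmult unit a b)) c = tr a b c"
      by (simp add: cls_pure act_minus)
    show "act_pos (rep (jj scale jmult unit a b)) d = - tr b a d"
      by (simp add: cls_pure act_plus)
    have "com (br a b) (br c d) - (br (tr a b c) d - br c (tr b a d)) \<in> K"
      using br_minus_right[of c "tr b a d"] by simp
    then show "C (jj scale jmult unit a b) (jj scale jmult unit c d) =
      jj scale jmult unit (tr a b c) d \<ominus>\<^bsub>Q\<^esub> jj scale jmult unit c (tr b a d)"
      unfolding cls_pure comQ cls.map_diff[symmetric] by (rule cls_eqI)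
  qed
  then show ?thesis by blast
qed

end

section \<open>The graded Lie algebra \<open>TKK(J)\<close>\<close>

text \<open>
  Any products with the prescribed values on generators agree with those computed in the free module,
  by induction on representatives. Hence the bracket of \<open>TKK(J)\<close> may be evaluated there.
\<close>

locale tkk_products_given = jordan_jj_no_two_torsion +
  fixes act_minus act_plus comQ
  assumes products: "tkk_products scale jmult unit act_minus act_plus comQ"
begin

lemma act_minus_bilinear: "bilinear_on Q (module_of scale) (module_of scale) act_minus"
  and act_plus_bilinear: "bilinear_on Q (module_of scale) (module_of scale) act_plus"
  and comQ_bilinear: "bilinear_on Q Q Q comQ"
  and on_pure: "act_minus (cls (br a b)) c = tr a b c" "act_plus (cls (br a b)) c = - tr b a c"
    "comQ (cls (br a b)) (cls (br c d)) = cls (br (tr a b c) d) \<ominus>\<^bsub>Q\<^esub> cls (br c (tr b a d))"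
  using products unfolding tkk_products_def Let_def jj_class_pure by blast+

lemma act_minus_cls: "act_minus (cls f) c = act_neg f c"
  using act_minus_bilinear
  by (induction f rule: free_module_induct)
    (simp_all add: on_pure cls.map_add cls.map_scale act_add act_scale bilinear_on_def module_of_def)

lemma act_plus_cls: "act_plus (cls f) c = act_pos f c"
  using act_plus_bilinear
  by (induction f rule: free_module_induct)
    (simp_all add: on_pure cls.map_add cls.map_scale act_add act_scale bilinear_on_def module_of_def)

lemma comQ_cls: "comQ (cls f) (cls g) = cls (com f g)"
proof -
  note lin = comQ_bilinear[unfolded bilinear_on_def]
  have *: "comQ (cls (br a b)) (cls g) = cls (com (br a b) g)" for a b
  proof (induction g rule: free_module_induct)
    case (pure c d)
    have "br (tr a b c) d - br c (tr b a d) - com (br a b) (br c d) =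
        - (br c (- tr b a d) + br c (tr b a d))"
      by simp
    also have "\<dots> \<in> K" by (intro null_minus br_minus_right)
    finally have "br (tr a b c) d - br c (tr b a d) - com (br a b) (br c d) \<in> K" .
    then show ?case unfolding on_pure cls.map_diff[symmetric] by (rule cls_eqI)
  qed (use lin in \<open>simp_all add: cls.map_add cls.map_scale com_add_right com_scale_right\<close>)
  show ?thesis
    by (induction f rule: free_module_induct)
      (use lin * in \<open>simp_all add: cls.map_add cls.map_scale cls_com_add_left cls_com_scale_left\<close>)
qed

abbreviation L where "L \<equiv> tkk_module scale jmult unit"
abbreviation brk where "brk \<equiv> tkk_bracket scale jmult unit act_minus act_plus comQ"
abbreviation part where "part \<equiv> tkk_component scale jmult unit"

definition el where "el a U b = (a, cls U, b)"

lemma carrier_L: "x \<in> carrier L \<longleftrightarrow> (\<exists>a U b. x = el a U b)"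
  by (auto simp: tkk_module_def Let_def el_def cls.carrier_eq)

lemma L_cases: "x \<in> carrier L \<Longrightarrow> (\<And>a U b. x = el a U b \<Longrightarrow> thesis) \<Longrightarrow> thesis"
  unfolding carrier_L by blast

lemma el_carrier [simp]: "el a U b \<in> carrier L"
  by (auto simp: carrier_L)

lemma L_add: "el a U b \<oplus>\<^bsub>L\<^esub> el a' U' b' = el (a + a') (U + U') (b + b')"
  by (simp add: tkk_module_def Let_def el_def cls.map_add)

lemma L_scale: "r \<odot>\<^bsub>L\<^esub> el a U b = el (scale r a) (free_scale r U) (scale r b)"
  by (simp add: tkk_module_def Let_def el_def cls.map_scale)

lemma L_zero: "\<zero>\<^bsub>L\<^esub> = el 0 0 0"
  by (simp add: tkk_module_def Let_def el_def cls.map_zero)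

lemma L_bracket: "brk (el a U b) (el c V d) =
  el (act_neg U c - act_neg V a) (com U V + br a d - br c b) (act_pos U d - act_pos V b)"
  by (simp add: tkk_bracket_def Let_def el_def act_minus_cls act_plus_cls comQ_cls jj_class_pure[symmetric]
      cls.map_add cls.map_diff)

lemma el_eq_iff: "el a U b = el a' U' b' \<longleftrightarrow> a = a' \<and> U - U' \<in> K \<and> b = b'"
  by (simp add: el_def cls_eq_iff)

lemma L_module: "Module.module base_ring L"
proof (intro module.intro module_axioms.intro cring_base)
  show "abelian_group L"
  proof (rule abelian_groupI)
    fix x assume "x \<in> carrier L"
    then obtain a U b where "x = el a U b" by (auto simp: carrier_L)
    then have "el (- a) (- U) (- b) \<oplus>\<^bsub>L\<^esub> x = \<zero>\<^bsub>L\<^esub>" by (simp add: L_add L_zero)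
    then show "\<exists>y\<in>carrier L. y \<oplus>\<^bsub>L\<^esub> x = \<zero>\<^bsub>L\<^esub>" by (meson el_carrier)
  qed (auto elim!: L_cases simp: L_add L_zero add.commute add.left_commute)
qed (auto elim!: L_cases simp: L_add L_scale scale_left_distrib scale_right_distrib
    free.scale_left_distrib free.scale_right_distrib)

lemma bracket_bilinear: "bilinear_on L L L brk"
proof -
  have add_left: "brk (x \<oplus>\<^bsub>L\<^esub> x') y = brk x y \<oplus>\<^bsub>L\<^esub> brk x' y"
    if "x \<in> carrier L" "x' \<in> carrier L" "y \<in> carrier L" for x x' y
  proof -
    obtain a U b a' U' b' c V d where [simp]: "x = el a U b" "x' = el a' U' b'" "y = el c V d"
      using \<open>x \<in> _\<close> \<open>x' \<in> _\<close> \<open>y \<in> _\<close> unfolding carrier_L by blast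
    have "(com (U + U') V + br (a + a') d - br c (b + b'))
        - (com U V + br a d - br c b + (com U' V + br a' d - br c b')) =
      (com (U + U') V - com U V - com U' V) + (br (a + a') d - br a d - br a' d)
      - (br c (b + b') - br c b - br c b')"
      by simp
    also have "\<dots> \<in> K" by (intro null_add null_diff com_add_left pure_add_left pure_add_right)
    finally show ?thesis
      by (simp add: L_add L_bracket el_eq_iff act_add act_add_right)
  qed
  have scale_left: "brk (r \<odot>\<^bsub>L\<^esub> x) y = r \<odot>\<^bsub>L\<^esub> brk x y" if "x \<in> carrier L" "y \<in> carrier L" for r x y
  proof -
    obtain a U b c V d where [simp]: "x = el a U b" "y = el c V d"
      using \<open>x \<in> _\<close> \<open>y \<in> _\<close> unfolding carrier_L by blast
    have "(com (free_scale r U) V + br (scale r a) d - br c (scale r b))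
        - free_scale r (com U V + br a d - br c b) =
      (com (free_scale r U) V - free_scale r (com U V)) + (br (scale r a) d - free_scale r (br a d))
      - (br c (scale r b) - free_scale r (br c b))"
      by (simp add: free.scale_right_distrib free.scale_right_diff_distrib)
    also have "\<dots> \<in> K" by (intro null_add null_diff com_scale_left pure_scale_left pure_scale_right)
    finally show ?thesis
      by (simp add: L_scale L_bracket el_eq_iff act_scale act_scale_right scale_right_diff_distrib)
  qed
  have add_right: "brk y (x \<oplus>\<^bsub>L\<^esub> x') = brk y x \<oplus>\<^bsub>L\<^esub> brk y x'"
    if "x \<in> carrier L" "x' \<in> carrier L" "y \<in> carrier L" for x x' y
  proof -
    obtain a U b a' U' b' c V d where [simp]: "x = el a U b" "x' = el a' U' b'" "y = el c V d"
      using \<open>x \<in> _\<close> \<open>x' \<in> _\<close> \<open>y \<in> _\<close> unfolding carrier_L by blast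
    have "(com V (U + U') + br c (b + b') - br (a + a') d)
        - (com V U + br c b - br a d + (com V U' + br c b' - br a' d)) =
      (br c (b + b') - br c b - br c b') - (br (a + a') d - br a d - br a' d)"
      by (simp add: com_add_right)
    also have "\<dots> \<in> K" by (intro null_diff pure_add_left pure_add_right)
    finally show ?thesis
      by (simp add: L_add L_bracket el_eq_iff act_add act_add_right)
  qed
  have scale_right: "brk y (r \<odot>\<^bsub>L\<^esub> x) = r \<odot>\<^bsub>L\<^esub> brk y x" if "x \<in> carrier L" "y \<in> carrier L" for r x y
  proof -
    obtain a U b c V d where [simp]: "x = el a U b" "y = el c V d"
      using \<open>x \<in> _\<close> \<open>y \<in> _\<close> unfolding carrier_L by blast
    have "(com V (free_scale r U) + br c (scale r b) - br (scale r a) d)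
        - free_scale r (com V U + br c b - br a d) =
      (br c (scale r b) - free_scale r (br c b)) - (br (scale r a) d - free_scale r (br a d))"
      by (simp add: com_scale_right free.scale_right_distrib free.scale_right_diff_distrib)
    also have "\<dots> \<in> K" by (intro null_diff pure_scale_left pure_scale_right)
    finally show ?thesis
      by (simp add: L_scale L_bracket el_eq_iff act_scale act_scale_right scale_right_diff_distrib)
  qed
  have closed: "brk x y \<in> carrier L" if "x \<in> carrier L" "y \<in> carrier L" for x y
    using that by (auto elim!: L_cases simp: L_bracket)
  show ?thesis
    unfolding bilinear_on_def
    by (intro conjI ballI allI closed add_left add_right scale_left scale_right)
qed

lemma bracket_alternating: "x \<in> carrier L \<Longrightarrow> brk x x = \<zero>\<^bsub>L\<^esub>"
  by (auto elim!: L_cases simp: L_bracket L_zero el_eq_iff com_alternating)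

text \<open>
  In degrees \<open>-1\<close> and \<open>1\<close> the terms with two actions cancel by \<open>act_com\<close>, and the triple products cancel
  in pairs by \<open>{a, b, c} = {c, b, a}\<close>. In degree \<open>0\<close> the triple commutators are \<open>com_jacobi\<close>; all other
  terms come from \<open>[X, \<langle>c, d\<rangle>] = \<langle>Xc, d\<rangle> + \<langle>c, Xd\<rangle>\<close> and cancel in the cyclic sum.
\<close>

lemma bracket_jacobi:
  assumes "x \<in> carrier L" "y \<in> carrier L" "z \<in> carrier L"
  shows "brk x (brk y z) \<oplus>\<^bsub>L\<^esub> brk y (brk z x) \<oplus>\<^bsub>L\<^esub> brk z (brk x y) = \<zero>\<^bsub>L\<^esub>"
proof -
  obtain a U b a' U' b' a'' U'' b'' where
    xyz: "x = el a U b" "y = el a' U' b'" "z = el a'' U'' b''"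
    using assms unfolding carrier_L by blast
  let ?n = act_neg and ?p = act_pos
  \<comment> \<open>The degree \<open>0\<close> component of \<open>[x, [y, z]]\<close>, and below its expansion modulo the relations.\<close>
  define m where "m a U b a' U' b' a'' U'' b'' =
    com U (com U' U'' + br a' b'' - br a'' b') + br a (?p U' b'' - ?p U'' b')
      - br (?n U' a'' - ?n U'' a') b" for a U b a' U' b' a'' U'' b''
  have m: "m a U b a' U' b' a'' U'' b'' - (com U (com U' U'')
      + (br (?n U a') b'' + br a' (?p U b'') - br (?n U a'') b' - br a'' (?p U b')
        + br a (?p U' b'') - br a (?p U'' b') - br (?n U' a'') b + br (?n U'' a') b)) \<in> K"
    for a U b a' U' b' a'' U'' b''
  proof -
    have "m a U b a' U' b' a'' U'' b'' - (com U (com U' U'')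
        + (br (?n U a') b'' + br a' (?p U b'') - br (?n U a'') b' - br a'' (?p U b')
          + br a (?p U' b'') - br a (?p U'' b') - br (?n U' a'') b + br (?n U'' a') b)) =
      (br a (?p U' b'' - ?p U'' b') - br a (?p U' b'') + br a (?p U'' b'))
      - (br (?n U' a'' - ?n U'' a') b - br (?n U' a'') b + br (?n U'' a') b)"
      by (simp add: m_def com_add_right com_diff_right)
    also have "\<dots> \<in> K" by (intro null_diff br_diff_left br_diff_right)
    finally show ?thesis .
  qed
  have "m a U b a' U' b' a'' U'' b'' + m a' U' b' a'' U'' b'' a U b + m a'' U'' b'' a U b a' U' b' \<in> K"
    using null_add[OF null_add[OF null_add[OF m[of a U b a' U' b' a'' U'' b''] m[of a' U' b' a'' U'' b'' a U b]]
      m[of a'' U'' b'' a U b a' U' b']] com_jacobi[of U U' U'']]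
    by simp
  moreover have act_diff: "?n (f - g) c = ?n f c - ?n g c" "?p (f - g) c = ?p f c - ?p g c" for f g c
    using act_add[of "f - g" g c] by simp_all
  ultimately show ?thesis
    by (simp add: xyz L_bracket L_add L_zero el_eq_iff m_def act_com act_add act_diff act_diff_right
        tr_outer_commute[of a' b'' a] tr_outer_commute[of a'' b' a] tr_outer_commute[of a'' b a']
        tr_outer_commute[of b' a'' b] tr_outer_commute[of b'' a' b] tr_outer_commute[of b'' a b'])
qed

text \<open>
  Outside degree \<open>0\<close> the middle entry is only required to represent zero, so that the components are closed under the
  operations on representatives.
\<close>

lemma mem_part_iff: "x \<in> part i \<longleftrightarrow>
    (\<exists>a U b. x = el a U b \<and> (i \<noteq> - 1 \<longrightarrow> a = 0) \<and> (i \<noteq> 0 \<longrightarrow> U \<in> K) \<and> (i \<noteq> 1 \<longrightarrow> b = 0))"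
  (is "_ \<longleftrightarrow> ?R")
proof
  have z: "\<zero>\<^bsub>Q\<^esub> = cls 0" by (simp add: cls.map_zero)
  show "x \<in> part i \<Longrightarrow> ?R"
    by (auto simp: tkk_component_def Let_def el_def cls.carrier_eq z split: if_splits intro: null_zero)
  show "?R \<Longrightarrow> x \<in> part i"
    by (auto simp: tkk_component_def Let_def el_def cls_null)
qed

lemma part_submodule: "submodule (part i) base_ring L"
proof -
  interpret Module.module base_ring L by (rule L_module)
  have minus: "\<ominus>\<^bsub>L\<^esub> el a U b = el (- a) (- U) (- b)" for a U b
    by (rule M.minus_equality) (simp_all add: L_add L_zero)
  have part_I: "el a U b \<in> part i"
    if "i \<noteq> - 1 \<Longrightarrow> a = 0" "i \<noteq> 0 \<Longrightarrow> U \<in> K" "i \<noteq> 1 \<Longrightarrow> b = 0" for a U b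
    using that unfolding mem_part_iff by blast
  show ?thesis
  proof (rule submoduleI)
    show "part i \<subseteq> carrier L" by (auto simp: mem_part_iff)
    show "\<zero>\<^bsub>L\<^esub> \<in> part i" unfolding L_zero by (rule part_I) simp_all
  next
    fix x assume "x \<in> part i"
    then show "\<ominus>\<^bsub>L\<^esub> x \<in> part i"
      unfolding mem_part_iff[of x] by (elim exE conjE) (simp add: minus part_I null_minus)
  next
    fix x y assume "x \<in> part i" "y \<in> part i"
    then show "x \<oplus>\<^bsub>L\<^esub> y \<in> part i"
      unfolding mem_part_iff[of x] mem_part_iff[of y]
      by (elim exE conjE) (simp add: L_add part_I null_add)
  next
    fix c x assume "x \<in> part i"
    then show "c \<odot>\<^bsub>L\<^esub> x \<in> part i"
      unfolding mem_part_iff[of x] by (elim exE conjE) (simp add: L_scale part_I null_scale)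
  qed
qed

lemma part_bracket:
  assumes "x \<in> part i" "y \<in> part j"
  shows "brk x y \<in> part (i + j)"
proof -
  from assms obtain a U b c V d where xy: "x = el a U b" "y = el c V d"
    and x: "i \<noteq> - 1 \<Longrightarrow> a = 0" "i \<noteq> 0 \<Longrightarrow> U \<in> K" "i \<noteq> 1 \<Longrightarrow> b = 0"
    and y: "j \<noteq> - 1 \<Longrightarrow> c = 0" "j \<noteq> 0 \<Longrightarrow> V \<in> K" "j \<noteq> 1 \<Longrightarrow> d = 0"
    unfolding mem_part_iff by blast
  have act_zero: "act_neg W 0 = 0" "act_pos W 0 = 0" for W
    using act_diff_right[of W 0 0] by simp_all
  have "act_neg U c - act_neg V a = 0" if "i + j \<noteq> - 1"
  proof -
    have "act_neg U c = 0" using that x(2) y(1) by (cases "i = 0") (auto simp: act_zero act_null)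
    moreover have "act_neg V a = 0" using that x(1) y(2) by (cases "j = 0") (auto simp: act_zero act_null)
    ultimately show ?thesis by simp
  qed
  moreover have "act_pos U d - act_pos V b = 0" if "i + j \<noteq> 1"
  proof -
    have "act_pos U d = 0" using that x(2) y(3) by (cases "i = 0") (auto simp: act_zero act_null)
    moreover have "act_pos V b = 0" using that x(3) y(2) by (cases "j = 0") (auto simp: act_zero act_null)
    ultimately show ?thesis by simp
  qed
  moreover have "com U V + br a d - br c b \<in> K" if "i + j \<noteq> 0"
  proof (intro null_add null_diff)
    show "com U V \<in> K" using that x(2) y(2) by (cases "i = 0") (auto simp: com_null_left com_null_right)
    show "br a d \<in> K" using that x(1) y(3) by (cases "i = - 1") (auto simp: br_zero_left br_zero_right)
    show "br c b \<in> K" using that x(3) y(1) by (cases "i = 1") (auto simp: br_zero_left br_zero_right)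
  qed
  ultimately show ?thesis unfolding mem_part_iff xy L_bracket by blast
qed

lemma part_direct_sum:
  assumes "x \<in> carrier L"
  shows "\<exists>!(u, v, w). u \<in> part (- 1) \<and> v \<in> part 0 \<and> w \<in> part 1 \<and> x = u \<oplus>\<^bsub>L\<^esub> v \<oplus>\<^bsub>L\<^esub> w"
proof -
  obtain a U b where x: "x = el a U b" using assms unfolding carrier_L by blast
  have parts: "u \<in> part (- 1) \<longleftrightarrow> (\<exists>a. u = el a 0 0)" "v \<in> part 0 \<longleftrightarrow> (\<exists>U. v = el 0 U 0)"
    "w \<in> part 1 \<longleftrightarrow> (\<exists>b. w = el 0 0 b)" for u v w
    by (auto simp: tkk_component_def Let_def el_def cls.map_zero cls.carrier_eq)
  show ?thesis
  proof (rule ex1I[of _ "(el a 0 0, el 0 U 0, el 0 0 b)"])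
    show "case (el a 0 0, el 0 U 0, el 0 0 b) of (u, v, w) \<Rightarrow>
        u \<in> part (- 1) \<and> v \<in> part 0 \<and> w \<in> part 1 \<and> x = u \<oplus>\<^bsub>L\<^esub> v \<oplus>\<^bsub>L\<^esub> w"
      by (auto simp: parts x L_add)
    fix t assume "case t of (u, v, w) \<Rightarrow>
        u \<in> part (- 1) \<and> v \<in> part 0 \<and> w \<in> part 1 \<and> x = u \<oplus>\<^bsub>L\<^esub> v \<oplus>\<^bsub>L\<^esub> w"
    then obtain a' U' b' where "t = (el a' 0 0, el 0 U' 0, el 0 0 b')" "x = el a' U' b'"
      by (auto simp: parts L_add)
    then show "t = (el a 0 0, el 0 U 0, el 0 0 b)"
      using x by (simp add: el_eq_iff) (metis minus_diff_eq null_minus)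
  qed
qed

lemma three_graded: "three_graded_lie_algebra L brk part"
proof (intro three_graded_lie_algebra.intro lie_algebra.intro lie_algebra_axioms.intro
    three_graded_lie_algebra_axioms.intro L_module bracket_bilinear part_submodule)
  show "part i = {\<zero>\<^bsub>L\<^esub>}" if "\<bar>i\<bar> > 1" for i
    using that by (auto simp: tkk_component_def tkk_module_def Let_def)
  show "\<exists>!(u, v, w). u \<in> part (- 1) \<and> v \<in> part 0 \<and> w \<in> part 1 \<and> x = u \<oplus>\<^bsub>L\<^esub> v \<oplus>\<^bsub>L\<^esub> w"
    if "x \<in> carrier L" for x
    using that by (rule part_direct_sum)
  show "brk x y \<in> part (i + j)" if "x \<in> part i" "y \<in> part j" for x y i j
    using that by (rule part_bracket)
  show "brk x x = \<zero>\<^bsub>L\<^esub>" if "x \<in> carrier L" for x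
    using that by (rule bracket_alternating)
  show "brk x (brk y z) \<oplus>\<^bsub>L\<^esub> brk y (brk z x) \<oplus>\<^bsub>L\<^esub> brk z (brk x y) = \<zero>\<^bsub>L\<^esub>"
    if "x \<in> carrier L" "y \<in> carrier L" "z \<in> carrier L" for x y z
    using that by (rule bracket_jacobi)
qed

end

theorem corollary5p5:
  fixes scale :: "'k::comm_ring_1 \<Rightarrow> 'j::ab_group_add \<Rightarrow> 'j"
    and jmult :: "'j \<Rightarrow> 'j \<Rightarrow> 'j"
    and unit :: 'j
  assumes "unital_jordan_algebra scale jmult unit"
    and "\<forall>x::'k. 2 * x = 0 \<longrightarrow> x = 0"
    and "\<forall>x::'k. 3 * x = 0 \<longrightarrow> x = 0"
    and "jj_no_two_torsion scale jmult unit"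
  shows "(\<exists>act_minus act_plus com. tkk_products scale jmult unit act_minus act_plus com) \<and>
    (\<forall>act_minus act_plus com. tkk_products scale jmult unit act_minus act_plus com \<longrightarrow>
      three_graded_lie_algebra (tkk_module scale jmult unit)
        (tkk_bracket scale jmult unit act_minus act_plus com)
        (tkk_component scale jmult unit))"
proof -
  interpret p: linear_surjection "jj_module scale jmult unit" "jj_class scale jmult unit"
    by (rule linear_surjection_jj_class)
  have "f \<in> jj_null scale jmult unit" if "f + f \<in> jj_null scale jmult unit"
    for f :: "'j \<times> 'j \<Rightarrow>\<^sub>0 'k"
    using that assms(4) p.map_closed[of f]
    unfolding jj_class_eq_zero_iff[symmetric] p.map_add jj_no_two_torsion_def Let_def by blast
  then interpret jordan_jj_no_two_torsion scale jmult unit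
    by (intro jordan_jj_no_two_torsion.intro jordan_jj_no_two_torsion_axioms.intro assms(1))
  show ?thesis
  proof (intro conjI allI impI)
    show "\<exists>act_minus act_plus com. tkk_products scale jmult unit act_minus act_plus com"
      by (rule tkk_products_exist)
    fix act_minus act_plus com assume "tkk_products scale jmult unit act_minus act_plus com"
    then interpret tkk_products_given scale jmult unit act_minus act_plus com
      by unfold_locales
    show "three_graded_lie_algebra (tkk_module scale jmult unit)
        (tkk_bracket scale jmult unit act_minus act_plus com)
        (tkk_component scale jmult unit)"
      by (rule three_graded)
  qed
qed

end
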